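(* Let $\sigma$ be a type and $\mathcal O$ a regular family of $\sigma$-trees. Then for any $\sigma$-structure $\mathbf B$, there exists a homomorphism from $\mathbf B$ to $\mathbf D(\mathcal O)$ if and only if no tree in $\mathcal O$ admits a homomorphism to $\mathbf B$.
   Context: A type $\sigma$ is a finite set of relation symbols with arities; a $\sigma$-structure $\mathbf A$ is a finite set $V(\mathbf A)$ with an $r$-ary relation $R(\mathbf A)$ for each $R\in\sigma$ of arity $r$. Homomorphisms are relation-preserving maps. $\mathrm{Inc}(\mathbf A)$ is the bipartite multigraph with parts $V(\mathbf A)$ and the blocks $(R,(x_1,\dots,x_r))$, $(x_1,\dots,x_r)\in R(\mathbf A)$, with one edge joining $x_i$ to the block for each $i$. $\mathbf A$ is a $\sigma$-forest if $\mathrm{Inc}(\mathbf A)$ has no cycles or parallel edges, a $\sigma$-tree if moreover it is connected. $\mathbb F,\mathbb T$ are the isomorphism classes of $\sigma$-forests/trees, $\mathbb F_{\mathrm r},\mathbb T_{\mathrm r}$ those of rooted forests/trees $(\mathbf A,a)$. $(\mathbf A,a)+(\mathbf B,b)$: disjoint union with $a,b$ identified as the new root; $[(\mathbf A,a)]$ forgets the root; $\mathbf T_0$ is the one-vertex rooted tree with empty relations. For $\mathcal O\subseteq\mathbb F$, $\mathcal O-(\mathbf A,a)=\{(\mathbf B,b)\in\mathbb F_{\mathrm r}:[(\mathbf A,a)+(\mathbf B,b)]\in\mathcal O\}$; $\mathcal O$ is regular if there are finitely many distinct sets $\mathcal O-(\mathbf A,a)$. Concatenation: for $R$ of arity $r$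 and rooted structures $(\mathbf A_i,x_i)$, $\mathbf C(R,(\mathbf A_1,x_1),\dots,(\mathbf A_r,x_r))$ is the disjoint union of the $\mathbf A_i$ with the tuple $(x_1,\dots,x_r)$ added to $R$. $\mathbf D(\mathcal O)$ is the $\sigma$-structure whose vertices are the sets $\mathcal V\subseteq\mathbb T_{\mathrm r}$ such that (i) $\mathbf T_0\in\mathcal V$; (ii) if $(\mathbf A,a)\in\mathcal V$ then $\mathbf A\notin\mathcal O$; (iii) $\mathcal V=\mathbb T_{\mathrm r}\setminus\bigcup_{(\mathbf A,a)\in\mathcal H}(\mathcal O-(\mathbf A,a))$ for some family $\mathcal H$ of rooted trees. For $R\in\sigma$ of arity $r$, $(\mathcal V_1,\dots,\mathcal V_r)\in R(\mathbf D(\mathcal O))$ iff for every choice $(\mathbf A_i,a_i)\in\mathcal V_i$ ($i=1,\dots,r$), with $\mathbf T=\mathbf C(R,(\mathbf A_1,a_1),\dots,(\mathbf A_r,a_r))$, we have $(\mathbf T,a_j)\in\mathcal V_j$ for all $j=1,\dots,r$. *)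

theory Defs
  imports Main
begin

text \<open>A type sigma is a finite set Sig of relation symbols together with an arity
  function ar. A sigma-structure has a vertex set and, for each symbol, a set of tuples
  (represented as lists).\<close>

record ('v, 'r) struc =
  verts :: "'v set"
  rels  :: "'r \<Rightarrow> 'v list set"

definition wf_struc :: "'r set \<Rightarrow> ('r \<Rightarrow> nat) \<Rightarrow> ('v, 'r) struc \<Rightarrow> bool" where
  "wf_struc Sig ar A \<longleftrightarrow> finite (verts A) \<and> (\<forall>R. R \<notin> Sig \<longrightarrow> rels A R = {}) \<and>
     (\<forall>R\<in>Sig. \<forall>xs\<in>rels A R. length xs = ar R \<and> set xs \<subseteq> verts A)"

definition hom :: "'r set \<Rightarrow> ('a \<Rightarrow> 'b) \<Rightarrow> ('a, 'r) struc \<Rightarrow> ('b, 'r) struc \<Rightarrow> bool" where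
  "hom Sig h A B \<longleftrightarrow> (\<forall>v\<in>verts A. h v \<in> verts B) \<and>
     (\<forall>R\<in>Sig. \<forall>xs\<in>rels A R. map h xs \<in> rels B R)"

definition iso :: "'r set \<Rightarrow> ('a, 'r) struc \<Rightarrow> ('b, 'r) struc \<Rightarrow> bool" where
  "iso Sig A B \<longleftrightarrow> (\<exists>f. bij_betw f (verts A) (verts B) \<and>
     (\<forall>R\<in>Sig. \<forall>xs. set xs \<subseteq> verts A \<longrightarrow> (xs \<in> rels A R \<longleftrightarrow> map f xs \<in> rels B R)))"

definition riso :: "'r set \<Rightarrow> ('a, 'r) struc \<times> 'a \<Rightarrow> ('b, 'r) struc \<times> 'b \<Rightarrow> bool" where
  "riso Sig X Y \<longleftrightarrow> (\<exists>f. bij_betw f (verts (fst X)) (verts (fst Y)) \<and> f (snd X) = snd Y \<and>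
     (\<forall>R\<in>Sig. \<forall>xs. set xs \<subseteq> verts (fst X) \<longrightarrow>
        (xs \<in> rels (fst X) R \<longleftrightarrow> map f xs \<in> rels (fst Y) R)))"

subsection \<open>Incidence multigraph, forests and trees\<close>

definition inc_nodes :: "'r set \<Rightarrow> ('v, 'r) struc \<Rightarrow> ('v + ('r \<times> 'v list)) set" where
  "inc_nodes Sig A = Inl ` verts A \<union> {Inr (R, xs) | R xs. R \<in> Sig \<and> xs \<in> rels A R}"

definition inc_adj :: "'r set \<Rightarrow> ('v, 'r) struc \<Rightarrow> ('v + ('r \<times> 'v list)) rel" where
  "inc_adj Sig A =
     (let E = {(Inl v, Inr (R, xs)) | v R xs. R \<in> Sig \<and> xs \<in> rels A R \<and> v \<in> set xs}
      in E \<union> E\<inverse>)"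

text \<open>No parallel edges: no block contains the same vertex twice.\<close>
definition no_parallel :: "'r set \<Rightarrow> ('v, 'r) struc \<Rightarrow> bool" where
  "no_parallel Sig A \<longleftrightarrow> (\<forall>R\<in>Sig. \<forall>xs\<in>rels A R. distinct xs)"

definition has_cycle :: "'r set \<Rightarrow> ('v, 'r) struc \<Rightarrow> bool" where
  "has_cycle Sig A \<longleftrightarrow> (\<exists>ns. length ns \<ge> 3 \<and> distinct ns \<and> set ns \<subseteq> inc_nodes Sig A \<and>
     (\<forall>i<length ns. (ns ! i, ns ! (Suc i mod length ns)) \<in> inc_adj Sig A))"

definition inc_connected :: "'r set \<Rightarrow> ('v, 'r) struc \<Rightarrow> bool" where
  "inc_connected Sig A \<longleftrightarrow> inc_nodes Sig A \<noteq> {} \<and>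
     (\<forall>x\<in>inc_nodes Sig A. \<forall>y\<in>inc_nodes Sig A. (x, y) \<in> (inc_adj Sig A)\<^sup>*)"

definition is_forest :: "'r set \<Rightarrow> ('r \<Rightarrow> nat) \<Rightarrow> ('v, 'r) struc \<Rightarrow> bool" where
  "is_forest Sig ar A \<longleftrightarrow> wf_struc Sig ar A \<and> no_parallel Sig A \<and> \<not> has_cycle Sig A"

definition is_tree :: "'r set \<Rightarrow> ('r \<Rightarrow> nat) \<Rightarrow> ('v, 'r) struc \<Rightarrow> bool" where
  "is_tree Sig ar A \<longleftrightarrow> is_forest Sig ar A \<and> inc_connected Sig A"

text \<open>Isomorphism classes are represented by structures on the vertex type nat
  (every finite structure is isomorphic to one of these).\<close>

definition trees :: "'r set \<Rightarrow> ('r \<Rightarrow> nat) \<Rightarrow> (nat, 'r) struc set" where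
  "trees Sig ar = {A. is_tree Sig ar A}"

definition rforests :: "'r set \<Rightarrow> ('r \<Rightarrow> nat) \<Rightarrow> ((nat, 'r) struc \<times> nat) set" where
  "rforests Sig ar = {(A, a). is_forest Sig ar A \<and> a \<in> verts A}"

definition rtrees :: "'r set \<Rightarrow> ('r \<Rightarrow> nat) \<Rightarrow> ((nat, 'r) struc \<times> nat) set" where
  "rtrees Sig ar = {(A, a). is_tree Sig ar A \<and> a \<in> verts A}"

text \<open>The isomorphism class of X belongs to the family represented by Obs.\<close>
definition inO :: "'r set \<Rightarrow> (nat, 'r) struc set \<Rightarrow> ('a, 'r) struc \<Rightarrow> bool" where
  "inO Sig Obs X \<longleftrightarrow> (\<exists>C\<in>Obs. iso Sig X C)"

text \<open>The class of the rooted structure X belongs to the family represented by V.\<close>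
definition rmem :: "'r set \<Rightarrow> ((nat, 'r) struc \<times> nat) set \<Rightarrow> ('a, 'r) struc \<times> 'a \<Rightarrow> bool" where
  "rmem Sig \<V> X \<longleftrightarrow> (\<exists>Y\<in>\<V>. riso Sig X Y)"

text \<open>(A,a) + (B,b): disjoint union with a and b identified (root a).\<close>
definition glue :: "('a, 'r) struc \<Rightarrow> 'a \<Rightarrow> ('b, 'r) struc \<Rightarrow> 'b \<Rightarrow> ('a + 'b, 'r) struc" where
  "glue A a B b =
     (let g = (\<lambda>v. if v = b then Inl a else Inr v) in
      \<lparr> verts = Inl ` verts A \<union> Inr ` (verts B - {b}),
        rels = (\<lambda>R. map Inl ` rels A R \<union> map g ` rels B R) \<rparr>)"

definition Ominus :: "'r set \<Rightarrow> ('r \<Rightarrow> nat) \<Rightarrow> (nat, 'r) struc set \<Rightarrow> (nat, 'r) struc \<Rightarrow> nat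
     \<Rightarrow> ((nat, 'r) struc \<times> nat) set" where
  "Ominus Sig ar Obs A a = {(B, b) \<in> rforests Sig ar. inO Sig Obs (glue A a B b)}"

definition regular :: "'r set \<Rightarrow> ('r \<Rightarrow> nat) \<Rightarrow> (nat, 'r) struc set \<Rightarrow> bool" where
  "regular Sig ar Obs \<longleftrightarrow> finite ((\<lambda>(A, a). Ominus Sig ar Obs A a) ` rforests Sig ar)"

text \<open>Concatenation C(R, (A_1,x_1), ..., (A_r,x_r)); component i lives on vertices (i, v).\<close>
definition concat :: "'r \<Rightarrow> ((nat, 'r) struc \<times> nat) list \<Rightarrow> (nat \<times> nat, 'r) struc" where
  "concat R ts =
     \<lparr> verts = {(i, v). i < length ts \<and> v \<in> verts (fst (ts ! i))},
       rels = (\<lambda>S. (\<Union>i<length ts. map (Pair i) ` rels (fst (ts ! i)) S) \<union>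
                   (if S = R then {map (\<lambda>i. (i, snd (ts ! i))) [0..<length ts]} else {})) \<rparr>"

definition T0 :: "(nat, 'r) struc" where
  "T0 = \<lparr> verts = {0}, rels = (\<lambda>_. {}) \<rparr>"

definition D_verts :: "'r set \<Rightarrow> ('r \<Rightarrow> nat) \<Rightarrow> (nat, 'r) struc set
     \<Rightarrow> ((nat, 'r) struc \<times> nat) set set" where
  "D_verts Sig ar Obs = {\<V>.
     rmem Sig \<V> (T0, 0) \<and>
     (\<forall>(A, a)\<in>\<V>. \<not> inO Sig Obs A) \<and>
     (\<exists>\<H> \<subseteq> rtrees Sig ar. \<V> = rtrees Sig ar - (\<Union>(A, a)\<in>\<H>. Ominus Sig ar Obs A a))}"

definition D :: "'r set \<Rightarrow> ('r \<Rightarrow> nat) \<Rightarrow> (nat, 'r) struc set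
     \<Rightarrow> (((nat, 'r) struc \<times> nat) set, 'r) struc" where
  "D Sig ar Obs =
     \<lparr> verts = D_verts Sig ar Obs,
       rels = (\<lambda>R. if R \<in> Sig then
                 {Vs. length Vs = ar R \<and> set Vs \<subseteq> D_verts Sig ar Obs \<and>
                   (\<forall>ts. length ts = ar R \<longrightarrow> (\<forall>i<ar R. ts ! i \<in> Vs ! i) \<longrightarrow>
                      (\<forall>j<ar R. rmem Sig (Vs ! j) (concat R ts, (j, snd (ts ! j)))))}
               else {}) \<rparr>"

end

theory Submission
  imports Defs "HOL-Library.Countable"
begin

text \<open>Forward direction: for a homomorphism \<open>f\<close> from a tree \<open>T\<close> to \<open>D(O)\<close>, induction on the number
  of blocks shows \<open>(T, a) \<in> f a\<close>. Removing a block at \<open>a\<close> splits \<open>T\<close> into smaller rooted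
  trees whose concatenation is \<open>T\<close>, so the definition of the relations of \<open>D(O)\<close> applies. By
  condition (ii), \<open>T\<close> is then not in \<open>O\<close>.

  Backward direction: send \<open>b\<close> to the set of all rooted trees \<open>(A, a)\<close> such that whenever
  \<open>(K, c) + (A, a)\<close> lies in \<open>O\<close>, so does \<open>(K, c) + (A', a')\<close> for some rooted tree \<open>(A', a')\<close>
  mapping to \<open>(B, b)\<close>. A concatenation of such trees is treated by replacing its components one at
  a time, regarding everything outside the current component as the rooted tree \<open>(K, c)\<close>.\<close>

section \<open>Walks that avoid given blocks, and acyclicity in terms of vertices\<close>

text \<open>One link is a passage vertex, block, vertex in the incidence graph. Working with links
  keeps the later arguments on vertices and leaves the block nodes implicit.\<close>

definition link :: "'r set \<Rightarrow> ('v, 'r) struc \<Rightarrow> ('r \<times> 'v list) set \<Rightarrow> 'v rel" where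
  "link Sig A F = {(u, v). \<exists>S\<in>Sig. \<exists>ys\<in>rels A S. (S, ys) \<notin> F \<and> u \<in> set ys \<and> v \<in> set ys}"

text \<open>This is the cut form of acyclicity at a single block: once the block is deleted, its
  entries lie in pairwise different components.\<close>

definition separated :: "'r set \<Rightarrow> ('v, 'r) struc \<Rightarrow> 'r \<Rightarrow> 'v list \<Rightarrow> bool" where
  "separated Sig A R xs \<longleftrightarrow>
     (\<forall>i j. i < j \<longrightarrow> j < length xs \<longrightarrow> (xs ! i, xs ! j) \<notin> (link Sig A {(R, xs)})\<^sup>*)"

text \<open>Positions rather than vertices are compared in \<open>separated\<close>, so that \<open>acyc\<close> excludes
  parallel edges as well as cycles.\<close>
definition acyc :: "'r set \<Rightarrow> ('v, 'r) struc \<Rightarrow> bool" where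
  "acyc Sig A \<longleftrightarrow> (\<forall>R\<in>Sig. \<forall>xs\<in>rels A R. separated Sig A R xs)"

lemma wf_rels:
  assumes "wf_struc Sig ar A" "xs \<in> rels A R"
  shows "R \<in> Sig" "length xs = ar R" "set xs \<subseteq> verts A"
  using assms by (auto simp: wf_struc_def)

lemma sym_link: "sym (link Sig A F)"
  by (auto simp: sym_def link_def)

lemma link_rtrancl_sym: "(u, v) \<in> (link Sig A F)\<^sup>* \<Longrightarrow> (v, u) \<in> (link Sig A F)\<^sup>*"
  using sym_rtrancl[OF sym_link] by (metis symD)

text \<open>The closure \<open>s\<^sup>*\<close> in the second premise lets \<open>f\<close>
  collapse an edge to a point or stretch it to a longer walk; both happen below.\<close>

lemma rtrancl_image:
  assumes "(u, v) \<in> r\<^sup>*" and "\<And>x y. (x, y) \<in> r \<Longrightarrow> (f x, f y) \<in> s\<^sup>*"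
  shows "(f u, f v) \<in> s\<^sup>*"
  using assms(1) by induction (auto intro: rtrancl_trans assms(2))

lemma separatedD:
  assumes "separated Sig A R xs" "i < length xs" "j < length xs" "i \<noteq> j"
  shows "(xs ! i, xs ! j) \<notin> (link Sig A {(R, xs)})\<^sup>*"
  using assms unfolding separated_def by (metis link_rtrancl_sym linorder_neqE_nat)

lemma acyc_no_parallel: "acyc Sig A \<Longrightarrow> no_parallel Sig A"
  unfolding acyc_def no_parallel_def
  by (metis distinct_conv_nth rtrancl.rtrancl_refl separatedD)

section \<open>Agreement of \<open>acyc\<close> with the absence of cycles and parallel
  edges\<close>

lemma inc_adj_simps [simp]:
  "(Inl u, Inl v) \<notin> inc_adj Sig A"
  "(Inr p, Inr q) \<notin> inc_adj Sig A"
  "(Inl u, Inr (R, xs)) \<in> inc_adj Sig A \<longleftrightarrow> R \<in> Sig \<and> xs \<in> rels A R \<and> u \<in> set xs"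
  "(Inr (R, xs), Inl u) \<in> inc_adj Sig A \<longleftrightarrow> R \<in> Sig \<and> xs \<in> rels A R \<and> u \<in> set xs"
  by (auto simp: inc_adj_def Let_def)

text \<open>An invariant carried along a walk in the incidence graph that avoids \<open>F\<close>: a
  vertex node is linked to \<open>u\<close>, and a block node has an entry that is.\<close>

lemma inc_adj_ball_link:
  assumes "(p, q) \<in> inc_adj Sig A" "p \<notin> Inr ` F" "q \<notin> Inr ` F"
    and "case p of Inl w \<Rightarrow> (u, w) \<in> (link Sig A F)\<^sup>*
         | Inr (S, ys) \<Rightarrow> \<exists>w\<in>set ys. (u, w) \<in> (link Sig A F)\<^sup>*"
  shows "case q of Inl w \<Rightarrow> (u, w) \<in> (link Sig A F)\<^sup>*
         | Inr (S, ys) \<Rightarrow> \<exists>w\<in>set ys. (u, w) \<in> (link Sig A F)\<^sup>*"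
proof (cases p)
  case (Inl a)
  then show ?thesis using assms by (cases q) auto
next
  case p: (Inr b)
  obtain S ys where b: "b = (S, ys)" by force
  obtain v where q: "q = Inl v" using assms(1) p by (cases q) auto
  obtain w where w: "w \<in> set ys" "(u, w) \<in> (link Sig A F)\<^sup>*" using assms(4) p b by auto
  have "(w, v) \<in> link Sig A F"
    using assms(1,2) w(1) unfolding p b q link_def by auto
  then show ?thesis using w(2) q by auto
qed

lemma mod_shift_inj:
  fixes k m m' n :: nat
  assumes "k < n" "m < n" "m' < n" "(k + m) mod n = (k + m') mod n"
  shows "m = m'"
proof -
  have "(k + m) mod n = (if k + m < n then k + m else k + m - n)" if "m < n" for m
    using that assms(1) by (auto simp: le_mod_geq)
  then show ?thesis using assms by (auto split: if_splits)
qed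

text \<open>A cycle passes through some block. Its two neighbours on the cycle are different entries
  of that block, and the rest of the cycle links them without using it, against
  \<open>separated\<close>.\<close>

lemma acyc_no_cycle:
  assumes "acyc Sig A" shows "\<not> has_cycle Sig A"
proof
  assume "has_cycle Sig A"
  then obtain ns where n3: "length ns \<ge> 3" and dist: "distinct ns"
    and adj: "\<And>i. i < length ns \<Longrightarrow> (ns ! i, ns ! (Suc i mod length ns)) \<in> inc_adj Sig A"
    unfolding has_cycle_def by blast
  define n where "n = length ns"
  \<comment> \<open>Vertices and blocks alternate, so one of the first two nodes is a block.\<close>
  have "\<exists>k<n. \<exists>e. ns ! k = Inr e"
  proof (cases "ns ! 0")
    case (Inl a)
    have "(ns ! 0, ns ! 1) \<in> inc_adj Sig A" using adj[of 0] n3 mod_less[of 1 "length ns"] by fastforce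
    then have "\<exists>e. ns ! 1 = Inr e" using Inl by (cases "ns ! 1") auto
    moreover have "1 < n" using n3 n_def by simp
    ultimately show ?thesis by blast
  next
    case (Inr b)
    then show ?thesis using n3 n_def by (metis le_zero_eq linorder_not_less numeral_3_eq_3 nat.distinct(1))
  qed
  then obtain k R xs where k: "k < n" "ns ! k = Inr (R, xs)" by force
  \<comment> \<open>The cycle is reread from position \<open>k\<close>, so that it starts at the
    block and returns to it at index \<open>n\<close>.\<close>
  define c where "c m = ns ! ((k + m) mod n)" for m
  have npos: "n > 0" using k by simp
  have c_adj: "(c m, c (Suc m)) \<in> inc_adj Sig A" for m
    using adj[of "(k + m) mod n"] npos unfolding c_def n_def[symmetric] by (simp add: mod_Suc_eq)
  have c_inj: "c m = c m' \<Longrightarrow> m < n \<Longrightarrow> m' < n \<Longrightarrow> m = m'" for m m'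
    using mod_shift_inj[OF k(1), of m m'] dist npos
      nth_eq_iff_index_eq[of ns "(k + m) mod n" "(k + m') mod n"]
    unfolding c_def n_def by auto
  have c0: "c 0 = Inr (R, xs)" "c n = Inr (R, xs)" using k by (simp_all add: c_def)
  obtain u where u: "c 1 = Inl u" "u \<in> set xs" "R \<in> Sig" "xs \<in> rels A R"
    using c_adj[of 0] c0 by (cases "c 1") auto
  have cn: "(c (n - 1), c n) \<in> inc_adj Sig A" using c_adj[of "n - 1"] npos by simp
  then obtain v where v: "c (n - 1) = Inl v" "v \<in> set xs"
    using c0 by (cases "c (n - 1)") auto
  \<comment> \<open>Equal neighbours would make \<open>c 1\<close> and \<open>c (n - 1)\<close>
    coincide, hence \<open>n = 2\<close>, too short for a cycle.\<close>
  have uv: "u \<noteq> v"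
  proof
    assume "u = v"
    then have "c 1 = c (n - 1)" using u v by simp
    then have "1 = n - 1" using c_inj[of 1 "n - 1"] n3 unfolding n_def by linarith
    then show False using n3 unfolding n_def by linarith
  qed
  let ?L = "(link Sig A {(R, xs)})\<^sup>*"
  \<comment> \<open>The invariant holds at all indices strictly between 0 and \<open>n\<close>; by
    injectivity of \<open>c\<close> none of these nodes is the block itself.\<close>
  have "case c (Suc m) of Inl w \<Rightarrow> (u, w) \<in> ?L | Inr (S, ys) \<Rightarrow> \<exists>w\<in>set ys. (u, w) \<in> ?L"
    if "Suc m < n" for m
    using that
  proof (induction m)
    case 0
    then show ?case using u by simp
  next
    case (Suc m)
    have "c (Suc m) \<noteq> c 0" "c (Suc (Suc m)) \<noteq> c 0"
      using c_inj[of "Suc m" 0] c_inj[of "Suc (Suc m)" 0] Suc.prems by auto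
    then show ?case
      using inc_adj_ball_link[OF c_adj, of "Suc m"] Suc c0 by auto
  qed
  from this[of "n - 2"] have "(u, v) \<in> ?L" using v n3 n_def
    by (simp add: numeral_2_eq_2 Suc_diff_Suc)
  moreover obtain i j where "i < length xs" "j < length xs" "xs ! i = u" "xs ! j = v"
    using u(2) v(2) by (metis in_set_conv_nth)
  ultimately show False
    using separatedD[of Sig A R xs i j] assms u uv unfolding acyc_def by auto
qed

text \<open>The path is grown edge by edge. If the new endpoint is already on it, the path is cut
  back to that point. The bound by \<open>Range E\<close> later places the nodes in the incidence
  graph.\<close>

lemma rtrancl_distinct_path:
  assumes "(x, y) \<in> E\<^sup>*"
  shows "\<exists>ns. ns \<noteq> [] \<and> hd ns = x \<and> last ns = y \<and> distinct ns \<and>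
     set ns \<subseteq> insert x (Range E) \<and> successively (\<lambda>a b. (a, b) \<in> E) ns"
  using assms
proof induction
  case base
  show ?case by (rule exI[of _ "[x]"]) auto
next
  case (step y z)
  then obtain ns where ns: "ns \<noteq> []" "hd ns = x" "last ns = y" "distinct ns"
     "set ns \<subseteq> insert x (Range E)" "successively (\<lambda>a b. (a, b) \<in> E) ns" by blast
  show ?case
  proof (cases "z \<in> set ns")
    case True
    then obtain as bs where "ns = as @ z # bs" by (metis split_list)
    then have "ns = (as @ [z]) @ bs" by simp
    then show ?thesis using ns
      by (intro exI[of _ "as @ [z]"]) (auto simp: successively_append_iff hd_append)
  next
    case False
    then show ?thesis using ns step
      by (intro exI[of _ "ns @ [z]"]) (auto simp: successively_append_iff)
  qed
qed

text \<open>A walk that joins two positions of a block without using it yields a simple path in the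
  incidence graph, and adding the block closes the path to a cycle. Absence of parallel edges makes
  the two endpoints different.\<close>

lemma no_cycle_acyc:
  assumes wf: "wf_struc Sig ar A" and np: "no_parallel Sig A" and nc: "\<not> has_cycle Sig A"
  shows "acyc Sig A"
  unfolding acyc_def separated_def
proof (intro ballI allI impI notI)
  fix R xs i j
  assume R: "R \<in> Sig" "xs \<in> rels A R" and ij: "i < j" "j < length xs"
    and path: "(xs ! i, xs ! j) \<in> (link Sig A {(R, xs)})\<^sup>*"
  define u where "u = xs ! i"
  define v where "v = xs ! j"
  have uv: "u \<noteq> v" "u \<in> set xs" "v \<in> set xs"
    using np R ij unfolding no_parallel_def u_def v_def by (auto simp: nth_eq_iff_index_eq)
  \<comment> \<open>The incidence graph with the block deleted: a path in it stays free of
    repetitions when the block is appended.\<close>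
  define E where "E = {(p, q) \<in> inc_adj Sig A. p \<noteq> Inr (R, xs) \<and> q \<noteq> Inr (R, xs)}"
  have "(Inl u, Inl v) \<in> E\<^sup>*" unfolding u_def v_def
  proof (rule rtrancl_image[OF path])
    fix x y assume "(x, y) \<in> link Sig A {(R, xs)}"
    then obtain S ys where "S \<in> Sig" "ys \<in> rels A S" "(S, ys) \<noteq> (R, xs)" "x \<in> set ys" "y \<in> set ys"
      by (auto simp: link_def)
    then have "(Inl x, Inr (S, ys)) \<in> E" "(Inr (S, ys), Inl y) \<in> E" by (auto simp: E_def)
    then show "(Inl x, Inl y) \<in> E\<^sup>*" by (meson converse_rtrancl_into_rtrancl r_into_rtrancl)
  qed
  then obtain ns where ns: "ns \<noteq> []" "hd ns = Inl u" "last ns = Inl v" "distinct ns"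
    "set ns \<subseteq> insert (Inl u) (Range E)" "successively (\<lambda>a b. (a, b) \<in> E) ns"
    by (metis rtrancl_distinct_path)
  define cs where "cs = ns @ [Inr (R, xs)]"
  have len: "length ns \<ge> 2" using ns(1-3) uv(1) by (cases ns; cases "tl ns") auto
  have "Range E \<subseteq> inc_nodes Sig A - {Inr (R, xs)}"
    using wf_rels(3)[OF wf] unfolding E_def inc_adj_def inc_nodes_def Let_def by (auto; blast)
  moreover have "Inl u \<in> inc_nodes Sig A"
    using wf_rels[OF wf R(2)] uv by (auto simp: inc_nodes_def)
  ultimately have nodes: "set ns \<subseteq> inc_nodes Sig A - {Inr (R, xs)}"
    using ns(5) Inl_not_Inr[of u "(R, xs)"] by blast
  have "(cs ! k, cs ! (Suc k mod length cs)) \<in> inc_adj Sig A" if k: "k < length cs" for k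
  proof -
    consider "Suc k < length ns" | "Suc k = length ns" | "k = length ns" using k cs_def by force
    then show ?thesis
    proof cases
      case 1
      then have "(ns ! k, ns ! Suc k) \<in> E" using ns(6) by (simp add: successively_conv_nth)
      then show ?thesis using 1 by (auto simp: cs_def nth_append E_def)
    next
      case 2
      then have "ns ! k = Inl v" using ns(1,3) by (metis diff_Suc_1 last_conv_nth)
      then show ?thesis using 2 uv R by (auto simp: cs_def nth_append)
    next
      case 3
      have "ns ! 0 = Inl u" using ns(1,2) by (simp add: hd_conv_nth)
      then show ?thesis using 3 uv R ns(1) by (auto simp: cs_def nth_append)
    qed
  qed
  moreover have "Inr (R, xs) \<in> inc_nodes Sig A" using R by (auto simp: inc_nodes_def)
  ultimately have "has_cycle Sig A" unfolding has_cycle_def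
    using len ns(4) nodes by (intro exI[of _ cs]) (auto simp: cs_def)
  then show False using nc by blast
qed

section \<open>Connectivity and the working description of trees\<close>

definition reach :: "'r set \<Rightarrow> ('v, 'r) struc \<Rightarrow> 'v \<Rightarrow> bool" where
  "reach Sig A a \<longleftrightarrow> a \<in> verts A \<and> (\<forall>v\<in>verts A. (a, v) \<in> (link Sig A {})\<^sup>*)"

text \<open>Every block has an entry because arities are positive, so a block node is reached as
  soon as all vertices are.\<close>

lemma inc_connected_iff:
  assumes wf: "wf_struc Sig ar A" and ar: "\<forall>R\<in>Sig. ar R > 0" and a: "a \<in> verts A"
  shows "inc_connected Sig A \<longleftrightarrow> reach Sig A a"
proof
  assume c: "inc_connected Sig A"
  have "(a, v) \<in> (link Sig A {})\<^sup>*" if v: "v \<in> verts A" for v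
  proof -
    have "(Inl a, Inl v) \<in> (inc_adj Sig A)\<^sup>*"
      using c a v unfolding inc_connected_def inc_nodes_def by blast
    then have "case (Inl v :: 'b + 'a \<times> 'b list) of Inl w \<Rightarrow> (a, w) \<in> (link Sig A {})\<^sup>*
         | Inr (S, ys) \<Rightarrow> \<exists>w\<in>set ys. (a, w) \<in> (link Sig A {})\<^sup>*"
    proof induction
      case base
      then show ?case by simp
    next
      case (step y z)
      then show ?case using inc_adj_ball_link[of y z Sig A "{}" a] by auto
    qed
    then show ?thesis by simp
  qed
  then show "reach Sig A a" using a by (simp add: reach_def)
next
  assume r: "reach Sig A a"
  let ?E = "inc_adj Sig A"
  have symE: "sym (?E\<^sup>*)" by (rule sym_rtrancl) (auto simp: inc_adj_def Let_def sym_def)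
  have vert: "(Inl a, Inl v) \<in> ?E\<^sup>*" if "v \<in> verts A" for v
  proof (rule rtrancl_image[where f = Inl and r = "link Sig A {}"])
    show "(a, v) \<in> (link Sig A {})\<^sup>*" using r that by (simp add: reach_def)
    fix x y assume "(x, y) \<in> link Sig A {}"
    then obtain S ys where "S \<in> Sig" "ys \<in> rels A S" "x \<in> set ys" "y \<in> set ys"
      by (auto simp: link_def)
    then have "(Inl x, Inr (S, ys)) \<in> ?E" "(Inr (S, ys), Inl y) \<in> ?E" by auto
    then show "(Inl x, Inl y) \<in> ?E\<^sup>*" by (meson converse_rtrancl_into_rtrancl r_into_rtrancl)
  qed
  have "(Inl a, p) \<in> ?E\<^sup>*" if node: "p \<in> inc_nodes Sig A" for p
  proof (cases p)
    case (Inl v)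
    then show ?thesis using node vert by (auto simp: inc_nodes_def)
  next
    case (Inr b)
    then obtain S ys where p: "p = Inr (S, ys)" "S \<in> Sig" "ys \<in> rels A S"
      using node by (cases b) (auto simp: inc_nodes_def)
    then have "ys \<noteq> []" using wf_rels[OF wf p(3)] ar by auto
    then obtain v where "v \<in> set ys" by (cases ys) auto
    moreover from this have "v \<in> verts A" using wf_rels[OF wf p(3)] by auto
    ultimately show ?thesis using p vert by (metis inc_adj_simps(3) rtrancl.rtrancl_into_rtrancl)
  qed
  moreover have "inc_nodes Sig A \<noteq> {}" using a by (auto simp: inc_nodes_def)
  ultimately show "inc_connected Sig A" unfolding inc_connected_def
    using symE by (meson rtrancl_trans symD)
qed

lemma is_tree_iff:
  assumes "\<forall>R\<in>Sig. ar R > 0" "a \<in> verts A"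
  shows "is_tree Sig ar A \<longleftrightarrow> wf_struc Sig ar A \<and> acyc Sig A \<and> reach Sig A a"
  using assms inc_connected_iff[of Sig ar A a] acyc_no_cycle[of Sig A] acyc_no_parallel[of Sig A]
    no_cycle_acyc[of Sig ar A]
  unfolding is_tree_def is_forest_def by blast


section \<open>Transport of links, and retractions\<close>

lemma link_image:
  assumes "(u, v) \<in> (link Sig A {})\<^sup>*"
    and "\<And>S ys. S \<in> Sig \<Longrightarrow> ys \<in> rels A S \<Longrightarrow> map f ys \<in> rels X S"
  shows "(f u, f v) \<in> (link Sig X {})\<^sup>*"
  using assms(1)
proof (rule rtrancl_image)
  fix x y assume "(x, y) \<in> link Sig A {}"
  then obtain S ys where "S \<in> Sig" "ys \<in> rels A S" "x \<in> set ys" "y \<in> set ys"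
    by (auto simp: link_def)
  then have "(f x, f y) \<in> link Sig X {}"
    using assms(2)[of S ys] unfolding link_def by force
  then show "(f x, f y) \<in> (link Sig X {})\<^sup>*" by blast
qed

text \<open>A retraction onto the part containing a block, which collapses every block outside that
  part to a point, turns a walk avoiding the block into a walk inside the part.\<close>
lemma separated_retract:
  assumes sep: "separated Sig A S zs"
    and inv: "\<And>v. v \<in> set zs \<Longrightarrow> \<rho> (f v) = v"
    and step: "\<And>S' ys. S' \<in> Sig \<Longrightarrow> ys \<in> rels X S' \<Longrightarrow>
      (\<forall>u\<in>set ys. \<forall>v\<in>set ys. \<rho> u = \<rho> v) \<or> map \<rho> ys \<in> rels A S' \<and> map f (map \<rho> ys) = ys"
  shows "separated Sig X S (map f zs)"
  unfolding separated_def
proof (intro allI impI notI)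
  fix i j assume ij: "i < j" "j < length (map f zs)"
    and "(map f zs ! i, map f zs ! j) \<in> (link Sig X {(S, map f zs)})\<^sup>*"
  then have "(f (zs ! i), f (zs ! j)) \<in> (link Sig X {(S, map f zs)})\<^sup>*" by simp
  then have "(\<rho> (f (zs ! i)), \<rho> (f (zs ! j))) \<in> (link Sig A {(S, zs)})\<^sup>*"
  proof (rule rtrancl_image)
    fix x y assume "(x, y) \<in> link Sig X {(S, map f zs)}"
    then obtain S' ys where ys: "S' \<in> Sig" "ys \<in> rels X S'" "(S', ys) \<noteq> (S, map f zs)"
      "x \<in> set ys" "y \<in> set ys" by (auto simp: link_def)
    show "(\<rho> x, \<rho> y) \<in> (link Sig A {(S, zs)})\<^sup>*"
      using step[OF ys(1,2)]
    proof
      assume "\<forall>u\<in>set ys. \<forall>v\<in>set ys. \<rho> u = \<rho> v"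
      then show ?thesis using ys by (metis rtrancl.rtrancl_refl)
    next
      assume *: "map \<rho> ys \<in> rels A S' \<and> map f (map \<rho> ys) = ys"
      then have "(S', map \<rho> ys) \<noteq> (S, zs)" using ys(3) by auto
      then have "(\<rho> x, \<rho> y) \<in> link Sig A {(S, zs)}"
        using * ys unfolding link_def by force
      then show ?thesis by blast
    qed
  qed
  then show False using sep ij inv by (simp add: separated_def)
qed

text \<open>The identity serves as the retraction in \<open>separated_retract\<close>.\<close>

lemma acyc_mono:
  assumes "acyc Sig A" "\<And>S. S \<in> Sig \<Longrightarrow> rels B S \<subseteq> rels A S"
  shows "acyc Sig B"
  unfolding acyc_def
proof (intro ballI)
  fix S xs assume "S \<in> Sig" "xs \<in> rels B S"
  then have "separated Sig A S xs" using assms unfolding acyc_def by blast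
  from separated_retract[OF this, of id id B] show "separated Sig B S xs"
    using assms(2) by auto
qed

section \<open>Images of structures and isomorphism\<close>

definition mapS :: "('v \<Rightarrow> 'w) \<Rightarrow> ('v, 'r) struc \<Rightarrow> ('w, 'r) struc" where
  "mapS f A = \<lparr>verts = f ` verts A, rels = (\<lambda>R. map f ` rels A R)\<rparr>"

lemma mapS_simps [simp]:
  "verts (mapS f A) = f ` verts A" "rels (mapS f A) R = map f ` rels A R"
  by (simp_all add: mapS_def)

lemma struc_eqI: "verts A = verts B \<Longrightarrow> (\<And>S. rels A S = rels B S) \<Longrightarrow> (A :: ('v, 'r) struc) = B"
  by (rule struc.equality) auto

lemma wf_mapS: "wf_struc Sig ar A \<Longrightarrow> wf_struc Sig ar (mapS f A)"
  by (fastforce simp: wf_struc_def)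

text \<open>The inverse of \<open>f\<close> on the vertices is the retraction; well-formedness puts
  all tuples in its range of validity.\<close>

lemma acyc_mapS:
  assumes "wf_struc Sig ar A" "inj_on f (verts A)" "acyc Sig A"
  shows "acyc Sig (mapS f A)"
  unfolding acyc_def
proof (intro ballI)
  fix S xs assume S: "S \<in> Sig" "xs \<in> rels (mapS f A) S"
  have inv: "map (inv_into (verts A) f) (map f zs) = zs" if "zs \<in> rels A S'" for zs S'
    using wf_rels(3)[OF assms(1) that] assms(2) by (auto simp: map_idI subset_iff)
  obtain zs where zs: "zs \<in> rels A S" "xs = map f zs" using S by auto
  have "separated Sig A S zs" using assms(3) S zs by (auto simp: acyc_def)
  then show "separated Sig (mapS f A) S xs" unfolding zs(2)
  proof (rule separated_retract[where \<rho> = "inv_into (verts A) f"])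
    fix v assume "v \<in> set zs"
    then show "inv_into (verts A) f (f v) = v"
      using wf_rels(3)[OF assms(1) zs(1)] assms(2) by auto
  next
    fix S' ys assume "ys \<in> rels (mapS f A) S'"
    then obtain zs' where "zs' \<in> rels A S'" "ys = map f zs'" by auto
    then show "(\<forall>u\<in>set ys. \<forall>v\<in>set ys. inv_into (verts A) f u = inv_into (verts A) f v) \<or>
      map (inv_into (verts A) f) ys \<in> rels A S' \<and> map f (map (inv_into (verts A) f) ys) = ys"
      using inv by metis
  qed
qed

lemma reach_mapS: "reach Sig A a \<Longrightarrow> reach Sig (mapS f A) (f a)"
  unfolding reach_def by (auto intro: link_image[where f = f])

text \<open>The bijection hidden in \<open>iso\<close> and \<open>riso\<close> is made explicit, so
  that it can be composed, inverted and evaluated at a root.\<close>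

definition isom :: "'r set \<Rightarrow> ('a \<Rightarrow> 'b) \<Rightarrow> ('a, 'r) struc \<Rightarrow> ('b, 'r) struc \<Rightarrow> bool" where
  "isom Sig f A B \<longleftrightarrow> bij_betw f (verts A) (verts B) \<and>
     (\<forall>R\<in>Sig. \<forall>xs. set xs \<subseteq> verts A \<longrightarrow> (xs \<in> rels A R \<longleftrightarrow> map f xs \<in> rels B R))"

lemma iso_isom: "iso Sig A B \<longleftrightarrow> (\<exists>f. isom Sig f A B)"
  by (simp add: iso_def isom_def)

lemma riso_isom: "riso Sig (A, a) (B, b) \<longleftrightarrow> (\<exists>f. isom Sig f A B \<and> f a = b)"
  by (auto simp: riso_def isom_def)

lemma isom_trans: "isom Sig f A B \<Longrightarrow> isom Sig g B C \<Longrightarrow> isom Sig (g \<circ> f) A C"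
  unfolding isom_def
  by (auto intro: bij_betw_trans) (metis bij_betw_imp_surj_on image_mono list.set_map map_map)+

lemma isom_sym:
  assumes "isom Sig f A B" shows "isom Sig (inv_into (verts A) f) B A"
proof -
  let ?g = "inv_into (verts A) f"
  have f: "bij_betw f (verts A) (verts B)" using assms by (simp add: isom_def)
  then have g: "bij_betw ?g (verts B) (verts A)" by (rule bij_betw_inv_into)
  have "xs \<in> rels B R \<longleftrightarrow> map ?g xs \<in> rels A R" if "R \<in> Sig" "set xs \<subseteq> verts B" for R xs
  proof -
    have "map f (map ?g xs) = xs"
      using that(2) f by (auto simp: bij_betw_inv_into_right intro!: map_idI)
    moreover have "set (map ?g xs) \<subseteq> verts A" using that(2) g by (auto simp: bij_betw_def)
    ultimately show ?thesis using assms that(1) unfolding isom_def by metis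
  qed
  then show ?thesis using g by (simp add: isom_def)
qed

lemma isom_mapS:
  assumes "wf_struc Sig ar A" "inj_on f (verts A)" shows "isom Sig f A (mapS f A)"
  unfolding isom_def
proof (intro conjI ballI allI impI)
  show "bij_betw f (verts A) (verts (mapS f A))" using assms by (simp add: bij_betw_def)
  fix R xs assume R: "R \<in> Sig" "set xs \<subseteq> verts A"
  have "xs = ys" if "ys \<in> rels A R" "map f xs = map f ys" for ys
    using that R(2) wf_rels(3)[OF assms(1) that(1)] assms(2)
    by (metis Un_least inj_on_map_eq_map inj_on_subset)
  then show "xs \<in> rels A R \<longleftrightarrow> map f xs \<in> rels (mapS f A) R" by auto
qed

text \<open>An isomorphism controls only symbols of \<open>Sig\<close> and tuples over the vertices.
  Well-formed structures have no other tuples, so the target equals the image.\<close>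

lemma isom_eq_mapS:
  assumes "isom Sig f A B" "wf_struc Sig ar A" "wf_struc Sig ar B"
  shows "B = mapS f A" "inj_on f (verts A)"
proof -
  show inj: "inj_on f (verts A)" using assms(1) by (auto simp: isom_def bij_betw_def)
  have img: "f ` verts A = verts B" using assms(1) by (auto simp: isom_def bij_betw_def)
  show "B = mapS f A"
  proof (rule struc_eqI)
    show "verts B = verts (mapS f A)" using img by simp
    fix S show "rels B S = rels (mapS f A) S"
    proof (intro equalityI subsetI)
      fix ys assume ys: "ys \<in> rels B S"
      then have "set ys \<subseteq> f ` verts A" "S \<in> Sig" using wf_rels[OF assms(3)] img by auto
      define xs where "xs = map (inv_into (verts A) f) ys"
      have "ys = map f xs" "set xs \<subseteq> verts A"
        using \<open>set ys \<subseteq> f ` verts A\<close> unfolding xs_def map_map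
        by (auto simp: f_inv_into_f subset_iff inv_into_into intro!: map_idI[symmetric])
      then show "ys \<in> rels (mapS f A) S" using assms(1) ys \<open>S \<in> Sig\<close> by (auto simp: isom_def)
    next
      fix ys assume "ys \<in> rels (mapS f A) S"
      then obtain xs where xs: "ys = map f xs" "xs \<in> rels A S" by auto
      then show "ys \<in> rels B S"
        using assms(1) wf_rels[OF assms(2) xs(2)] unfolding isom_def by blast
    qed
  qed
qed

lemma iso_refl: "iso Sig A A"
  unfolding iso_isom isom_def by (auto intro!: exI[of _ id])

lemma iso_trans: "iso Sig A B \<Longrightarrow> iso Sig B C \<Longrightarrow> iso Sig A C"
  unfolding iso_isom using isom_trans by blast

lemma iso_sym: "iso Sig A B \<Longrightarrow> iso Sig B A"
  unfolding iso_isom using isom_sym by blast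

lemma inO_iso: "iso Sig A B \<Longrightarrow> inO Sig Obs A \<longleftrightarrow> inO Sig Obs B"
  unfolding inO_def by (meson iso_trans[of Sig A B] iso_trans[of Sig B A] iso_sym[of Sig A B])

lemma riso_trans: "riso Sig (A, a) (B, b) \<Longrightarrow> riso Sig (B, b) (C, c) \<Longrightarrow> riso Sig (A, a) (C, c)"
  unfolding riso_isom using isom_trans by (metis comp_apply)

lemma riso_sym:
  assumes "a \<in> verts A" "riso Sig (A, a) (B, b)" shows "riso Sig (B, b) (A, a)"
proof -
  obtain f where f: "isom Sig f A B" "f a = b" using assms(2) by (auto simp: riso_isom)
  then have "inv_into (verts A) f b = a"
    using assms(1) by (auto simp: isom_def bij_betw_def)
  then show ?thesis using isom_sym[OF f(1)] by (auto simp: riso_isom)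
qed

section \<open>Sums of rooted structures\<close>

text \<open>The embedding of the second summand; naming it makes \<open>glue\<close> the union of
  two images, symmetric in its summands.\<close>

definition glue_in :: "'a \<Rightarrow> 'b \<Rightarrow> 'b \<Rightarrow> 'a + 'b" where
  "glue_in a b v = (if v = b then Inl a else Inr v)"

lemma verts_glue:
  "a \<in> verts A \<Longrightarrow> b \<in> verts B \<Longrightarrow>
    verts (glue A a B b) = Inl ` verts A \<union> glue_in a b ` verts B"
  by (auto simp: glue_def Let_def glue_in_def)

lemma rels_glue: "rels (glue A a B b) S = map Inl ` rels A S \<union> map (glue_in a b) ` rels B S"
  by (simp add: glue_def Let_def glue_in_def[abs_def])

lemma wf_glue:
  assumes "wf_struc Sig ar A" "wf_struc Sig ar B" "a \<in> verts A" "b \<in> verts B"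
  shows "wf_struc Sig ar (glue A a B b)"
  using assms by (fastforce simp: wf_struc_def verts_glue rels_glue)

text \<open>Each summand is a retract of the sum: the other summand collapses to the common
  root.\<close>

lemma acyc_glue:
  assumes "acyc Sig A" "acyc Sig B" shows "acyc Sig (glue A a B b)"
  unfolding acyc_def
proof (intro ballI)
  fix S xs assume S: "S \<in> Sig" "xs \<in> rels (glue A a B b) S"
  then consider zs where "zs \<in> rels A S" "xs = map Inl zs"
    | zs where "zs \<in> rels B S" "xs = map (glue_in a b) zs" by (auto simp: rels_glue)
  then show "separated Sig (glue A a B b) S xs"
  proof cases
    case (1 zs)
    then have "separated Sig A S zs" using assms S by (auto simp: acyc_def)
    then show ?thesis unfolding 1(2)
      by (rule separated_retract[where \<rho> = "case_sum id (\<lambda>_. a)"])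
        (auto simp: rels_glue glue_in_def o_def)
  next
    case (2 zs)
    then have "separated Sig B S zs" using assms S by (auto simp: acyc_def)
    then show ?thesis unfolding 2(2)
      by (rule separated_retract[where \<rho> = "case_sum (\<lambda>_. b) id"])
        (auto simp: rels_glue glue_in_def o_def map_idI)
  qed
qed

lemma reach_glue:
  assumes "reach Sig A a" "reach Sig B b" shows "reach Sig (glue A a B b) (Inl a)"
proof -
  have ab: "a \<in> verts A" "b \<in> verts B" using assms by (auto simp: reach_def)
  have "(Inl a, Inl v) \<in> (link Sig (glue A a B b) {})\<^sup>*" if "v \<in> verts A" for v
    by (rule link_image[where A = A]) (use assms that in \<open>auto simp: reach_def rels_glue\<close>)
  moreover have "(glue_in a b b, glue_in a b v) \<in> (link Sig (glue A a B b) {})\<^sup>*"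
    if "v \<in> verts B" for v
    by (rule link_image[where A = B and f = "glue_in a b"])
      (use assms that in \<open>auto simp: reach_def rels_glue\<close>)
  moreover have "glue_in a b b = Inl a" by (simp add: glue_in_def)
  ultimately show ?thesis using ab by (auto simp: reach_def verts_glue)
qed

text \<open>A recognition criterion: a structure covered by two embedded copies that meet only in
  the root is their sum. All later isomorphisms of sums come from it.\<close>

lemma glue_iso:
  assumes "wf_struc Sig ar A" "wf_struc Sig ar B" "a \<in> verts A" "b \<in> verts B"
    and "inj_on f (verts A)" "inj_on g (verts B)" "f a = g b"
    and "f ` verts A \<inter> g ` verts B \<subseteq> {f a}"
    and "verts X = f ` verts A \<union> g ` verts B"
    and "\<And>S. rels X S = map f ` rels A S \<union> map g ` rels B S"
  shows "iso Sig (glue A a B b) X"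
proof -
  let ?h = "case_sum f g"
  have h: "?h (Inl v) = f v" "?h (glue_in a b w) = g w" for v w
    using assms(7) by (auto simp: glue_in_def)
  have "X = mapS ?h (glue A a B b)"
  proof (rule struc_eqI)
    show "verts X = verts (mapS ?h (glue A a B b))"
      using assms(3,4,9) h by (auto simp: verts_glue image_Un image_image)
    fix S
    have *: "map ?h (map Inl xs) = map f xs" "map ?h (map (glue_in a b) ys) = map g ys" for xs ys
      using h by auto
    then show "rels X S = rels (mapS ?h (glue A a B b)) S"
      unfolding mapS_simps rels_glue assms(10) image_Un image_image
      by (simp only: *)
  qed
  moreover have "inj_on ?h (verts (glue A a B b))"
  proof (rule inj_onI)
    fix x y assume xy: "x \<in> verts (glue A a B b)" "y \<in> verts (glue A a B b)" "?h x = ?h y"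
    \<comment> \<open>A value common to \<open>f\<close> and \<open>g\<close> is the root, so
      injectivity traces it back to \<open>a\<close> and \<open>b\<close>.\<close>
    have cross: "Inl v = glue_in a b w" if "v \<in> verts A" "w \<in> verts B" "f v = g w" for v w
    proof -
      have "f v = f a" using assms(8) that by auto
      moreover from this have "g w = g b" using that(3) assms(7) by simp
      ultimately have "v = a" "w = b" using that(1,2) assms(3-6) by (blast dest: inj_onD)+
      then show ?thesis by (simp add: glue_in_def)
    qed
    show "x = y"
      using xy h cross assms(3-6) unfolding verts_glue[OF assms(3,4)]
      by (auto dest: inj_onD)
  qed
  ultimately show ?thesis
    using isom_mapS[OF wf_glue[OF assms(1-4)], of ?h] iso_isom by blast
qed

lemma glue_mapS_left_iso:
  assumes "wf_struc Sig ar A" "wf_struc Sig ar B" "a \<in> verts A" "b \<in> verts B"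
    and "inj_on f (verts A)"
  shows "iso Sig (glue A a B b) (glue (mapS f A) (f a) B b)"
proof (rule glue_iso[where f = "Inl \<circ> f" and g = "glue_in (f a) b"])
  show "verts (glue (mapS f A) (f a) B b) =
    (Inl \<circ> f) ` verts A \<union> glue_in (f a) b ` verts B"
    using assms(3,4) by (simp add: verts_glue image_comp)
  show "rels (glue (mapS f A) (f a) B b) S =
    map (Inl \<circ> f) ` rels A S \<union> map (glue_in (f a) b) ` rels B S" for S
    by (simp add: rels_glue image_image)
qed (use assms in \<open>auto simp: glue_in_def inj_on_def\<close>)

lemma glue_mapS_right_iso:
  assumes "wf_struc Sig ar A" "wf_struc Sig ar B" "a \<in> verts A" "b \<in> verts B"
    and "inj_on f (verts B)"
  shows "iso Sig (glue A a B b) (glue A a (mapS f B) (f b))"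
proof (rule glue_iso[where f = Inl and g = "glue_in a (f b) \<circ> f"])
  show "verts (glue A a (mapS f B) (f b)) = Inl ` verts A \<union> (glue_in a (f b) \<circ> f) ` verts B"
    using assms(3,4) by (simp add: verts_glue image_comp)
  show "rels (glue A a (mapS f B) (f b)) S =
    map Inl ` rels A S \<union> map (glue_in a (f b) \<circ> f) ` rels B S" for S
    by (simp add: rels_glue image_image)
qed (use assms in \<open>auto simp: glue_in_def inj_on_def\<close>)

lemma T0_simps [simp]: "verts T0 = {0}" "rels T0 S = {}"
  by (simp_all add: T0_def)

lemma wf_T0: "wf_struc Sig ar T0"
  by (simp add: wf_struc_def)

text \<open>\<open>T0\<close> is neutral for sums, so membership in \<open>Obs\<close> itself is the
  case of the context \<open>T0\<close>.\<close>

lemma glue_T0_iso: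
  assumes "wf_struc Sig ar A" "a \<in> verts A" shows "iso Sig (glue T0 0 A a) A"
  by (rule glue_iso[OF wf_T0 assms(1), where f = "\<lambda>_. a" and g = id]) (use assms in auto)

section \<open>Concatenations\<close>

lemma verts_concat: "verts (concat R ts) = {(i, v). i < length ts \<and> v \<in> verts (fst (ts ! i))}"
  by (simp add: concat_def)

lemma rels_concat: "rels (concat R ts) S =
    (\<Union>i<length ts. map (Pair i) ` rels (fst (ts ! i)) S) \<union>
    (if S = R then {map (\<lambda>i. (i, snd (ts ! i))) [0..<length ts]} else {})"
  by (simp add: concat_def)

text \<open>For a block of component \<open>i\<close>, all other components collapse to the root of
  that component, and so does the new block. For the new block, deleting it leaves no link between
  different components.\<close>

lemma acyc_concat:
  assumes "\<And>i. i < length ts \<Longrightarrow> acyc Sig (fst (ts ! i))"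
  shows "acyc Sig (concat R ts)"
  unfolding acyc_def
proof (intro ballI)
  fix S xs assume S: "S \<in> Sig" "xs \<in> rels (concat R ts) S"
  let ?e = "map (\<lambda>i. (i, snd (ts ! i))) [0..<length ts]"
  consider i zs where "i < length ts" "zs \<in> rels (fst (ts ! i)) S" "xs = map (Pair i) zs"
    | "S = R" "xs = ?e" using S(2) by (auto simp: rels_concat split: if_splits)
  then show "separated Sig (concat R ts) S xs"
  proof cases
    case (1 i zs)
    then have "separated Sig (fst (ts ! i)) S zs" using assms S by (auto simp: acyc_def)
    then show ?thesis unfolding 1(3)
    proof (rule separated_retract[where \<rho> = "\<lambda>(k, v). if k = i then v else snd (ts ! i)"])
      fix S' ys assume "ys \<in> rels (concat R ts) S'"
      then consider k zs where "zs \<in> rels (fst (ts ! k)) S'" "ys = map (Pair k) zs" | "ys = ?e"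
        by (auto simp: rels_concat split: if_splits)
      then show "(\<forall>u\<in>set ys. \<forall>v\<in>set ys. (case u of (k, v) \<Rightarrow> if k = i then v else snd (ts ! i)) =
            (case v of (k, v) \<Rightarrow> if k = i then v else snd (ts ! i))) \<or>
          map (\<lambda>(k, v). if k = i then v else snd (ts ! i)) ys \<in> rels (fst (ts ! i)) S' \<and>
          map (Pair i) (map (\<lambda>(k, v). if k = i then v else snd (ts ! i)) ys) = ys"
        by cases (auto simp: o_def)
    qed auto
  next
    case 2
    have "fst u = fst v" if "(u, v) \<in> (link Sig (concat R ts) {(R, ?e)})\<^sup>*" for u v
      using that by induction (auto simp: link_def rels_concat split: if_splits)
    then show ?thesis unfolding 2 separated_def by fastforce
  qed
qed

section \<open>Closure of trees under the constructions\<close>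

text \<open>Positive arities exclude blocks without entries, which would be isolated nodes of the
  incidence graph.\<close>

locale signature =
  fixes Sig :: "'r set" and ar :: "'r \<Rightarrow> nat"
  assumes ar_pos: "\<forall>R\<in>Sig. ar R > 0"
begin

lemma treeD:
  assumes "is_tree Sig ar A"
  shows "wf_struc Sig ar A" "acyc Sig A" "a \<in> verts A \<Longrightarrow> reach Sig A a"
proof -
  show wf: "wf_struc Sig ar A" using assms by (simp add: is_tree_def is_forest_def)
  show "acyc Sig A" using assms no_cycle_acyc[OF wf] by (simp add: is_tree_def is_forest_def)
  show "reach Sig A a" if "a \<in> verts A"
    using assms is_tree_iff[OF ar_pos that] by simp
qed

lemma treeI: "wf_struc Sig ar A \<Longrightarrow> acyc Sig A \<Longrightarrow> reach Sig A a \<Longrightarrow> is_tree Sig ar A"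
  using is_tree_iff[OF ar_pos, of a A] by (simp add: reach_def)

lemma tree_nonempty:
  assumes "is_tree Sig ar A" obtains a where "a \<in> verts A"
proof -
  have "xs \<noteq> [] \<and> set xs \<subseteq> verts A" if "R \<in> Sig" "xs \<in> rels A R" for R xs
    using wf_rels[OF treeD(1)[OF assms] that(2)] ar_pos that(1) by auto
  moreover have "inc_nodes Sig A \<noteq> {}" using assms by (simp add: is_tree_def inc_connected_def)
  ultimately have "verts A \<noteq> {}" unfolding inc_nodes_def by fastforce
  then show thesis using that by blast
qed

lemma tree_T0: "is_tree Sig ar T0"
  by (rule treeI[of _ 0]) (auto simp: wf_T0 acyc_def reach_def)

lemma tree_mapS:
  assumes "is_tree Sig ar A" "inj_on f (verts A)" shows "is_tree Sig ar (mapS f A)"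
proof -
  obtain a where "a \<in> verts A" using assms(1) by (rule tree_nonempty)
  then show ?thesis
    using treeD[OF assms(1)] by (meson treeI wf_mapS acyc_mapS reach_mapS assms(2))
qed

lemma tree_glue:
  assumes "is_tree Sig ar A" "is_tree Sig ar B" "a \<in> verts A" "b \<in> verts B"
  shows "is_tree Sig ar (glue A a B b)"
  by (rule treeI[of _ "Inl a"])
    (use assms in \<open>auto intro!: wf_glue acyc_glue reach_glue dest: treeD\<close>)

lemma rtrees_iff: "(A, a) \<in> rtrees Sig ar \<longleftrightarrow> is_tree Sig ar A \<and> a \<in> verts A"
  by (simp add: rtrees_def)

lemma rtreesD: "t \<in> rtrees Sig ar \<Longrightarrow> is_tree Sig ar (fst t) \<and> snd t \<in> verts (fst t)"
  by (auto simp: rtrees_def)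

text \<open>For connectivity, the root of component 0 reaches every other root through the new
  block, and from there the whole component. Component 0 exists since the arity is positive.\<close>

lemma tree_concat:
  assumes R: "R \<in> Sig" "length ts = ar R" and ts: "\<And>i. i < ar R \<Longrightarrow> ts ! i \<in> rtrees Sig ar"
  shows "is_tree Sig ar (concat R ts)"
proof (rule treeI)
  note t = rtreesD[OF ts]
  let ?e = "map (\<lambda>i. (i, snd (ts ! i))) [0..<length ts]"
  let ?L = "link Sig (concat R ts) {}"
  have "finite (verts (fst (ts ! i)))" if "i < ar R" for i
    using treeD(1) t that by (auto simp: wf_struc_def)
  moreover have "verts (concat R ts) = Sigma {..<ar R} (\<lambda>i. verts (fst (ts ! i)))"
    using R by (auto simp: verts_concat)
  ultimately have "finite (verts (concat R ts))" by auto
  moreover have "S \<in> Sig \<and> length xs = ar S \<and> set xs \<subseteq> verts (concat R ts)"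
    if xs: "xs \<in> rels (concat R ts) S" for xs S
  proof -
    consider i zs where "i < ar R" "zs \<in> rels (fst (ts ! i)) S" "xs = map (Pair i) zs"
      | "S = R" "xs = ?e" using xs R(2) by (auto simp: rels_concat split: if_splits)
    then show ?thesis
    proof cases
      case (1 i zs)
      have "wf_struc Sig ar (fst (ts ! i))" using treeD(1) t 1(1) by blast
      from wf_rels[OF this 1(2)] show ?thesis using 1 R(2) by (auto simp: verts_concat)
    next
      case 2
      then show ?thesis using R t by (auto simp: verts_concat)
    qed
  qed
  ultimately show "wf_struc Sig ar (concat R ts)"
    unfolding wf_struc_def by blast
  show "acyc Sig (concat R ts)" using acyc_concat treeD(2) t R(2) by metis
  have e: "?e \<in> rels (concat R ts) R" by (simp add: rels_concat)
  have pos: "0 < ar R" using R(1) ar_pos by blast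
  have "((0, snd (ts ! 0)), (i, v)) \<in> ?L\<^sup>*" if i: "i < ar R" "v \<in> verts (fst (ts ! i))" for i v
  proof -
    have "(0, snd (ts ! 0)) \<in> set ?e" "(i, snd (ts ! i)) \<in> set ?e" using i pos R by auto
    then have "((0, snd (ts ! 0)), (i, snd (ts ! i))) \<in> ?L" using e R(1) unfolding link_def by blast
    moreover have "((i, snd (ts ! i)), (i, v)) \<in> ?L\<^sup>*"
    proof (rule link_image[where A = "fst (ts ! i)" and f = "Pair i"])
      have "reach Sig (fst (ts ! i)) (snd (ts ! i))"
        by (rule treeD(3)[OF t[OF i(1), THEN conjunct1] t[OF i(1), THEN conjunct2]])
      then show "(snd (ts ! i), v) \<in> (link Sig (fst (ts ! i)) {})\<^sup>*"
        using i(2) by (simp add: reach_def)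
    qed (use i R in \<open>auto simp: rels_concat\<close>)
    ultimately show ?thesis by (rule converse_rtrancl_into_rtrancl)
  qed
  then show "reach Sig (concat R ts) (0, snd (ts ! 0))"
    using pos R t unfolding reach_def verts_concat by auto
qed

lemma root_concat:
  assumes "length ts = ar R" "j < ar R" "ts ! j \<in> rtrees Sig ar"
  shows "(j, snd (ts ! j)) \<in> verts (concat R ts)"
  using assms rtreesD by (auto simp: verts_concat)

section \<open>Exchanging the components of a concatenation\<close>

text \<open>Replacing component \<open>k\<close> by a single vertex leaves a context
  \<open>rest\<close> that no longer depends on that component; gluing the component back at the
  placeholder \<open>c\<close> restores the whole. For \<open>k = j\<close> the placeholder is the
  root shared with \<open>H\<close>.\<close>

lemma glue_concat_split:
  fixes H :: "('a, 'r) struc"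
  assumes R: "R \<in> Sig" "length us = ar R" and us: "\<And>i. i < ar R \<Longrightarrow> us ! i \<in> rtrees Sig ar"
    and H: "is_tree Sig ar H" "h \<in> verts H" and jk: "j < ar R" "k < ar R"
  defines "us0 \<equiv> us[k := (T0, 0)]"
  defines "rest \<equiv> glue H h (concat R us0) (j, snd (us0 ! j))"
  defines "c \<equiv> glue_in h (j, snd (us0 ! j)) (k, 0)"
  shows "is_tree Sig ar rest" "c \<in> verts rest"
    and "iso Sig (glue rest c (fst (us ! k)) (snd (us ! k)))
           (glue H h (concat R us) (j, snd (us ! j)))"
proof -
  have us0: "us0 ! i \<in> rtrees Sig ar" if "i < ar R" for i
    using us[OF that] that R tree_T0 unfolding us0_def
    by (cases "i = k") (auto simp: rtrees_iff)
  have len0: "length us0 = ar R" using R by (simp add: us0_def)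
  have us0_k: "us0 ! k = (T0, 0)" using jk R by (simp add: us0_def)
  have us0_i: "us0 ! i = us ! i" if "i \<noteq> k" for i using that by (simp add: us0_def)
  note cT0 = tree_concat[OF R(1) len0 us0] and cT = tree_concat[OF R us]
  note rt0 = root_concat[OF len0 jk(1) us0[OF jk(1)]] and rt = root_concat[OF R(2) jk(1) us[OF jk(1)]]
  show tree: "is_tree Sig ar rest" unfolding rest_def by (rule tree_glue[OF H(1) cT0 H(2) rt0])
  have vrest: "verts rest = Inl ` verts H \<union>
      glue_in h (j, snd (us0 ! j)) ` {(i, v). i < ar R \<and> v \<in> verts (fst (us0 ! i))}"
    unfolding rest_def verts_glue[OF H(2) rt0] unfolding verts_concat len0 ..
  show c: "c \<in> verts rest" unfolding c_def vrest using jk us0_k by auto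
  define a where "a = snd (us ! k)"
  \<comment> \<open>\<open>\<sigma>\<close> embeds \<open>rest\<close> in the full structure by
    renaming the placeholder to the root \<open>a\<close> of component \<open>k\<close>. If
    \<open>k = j\<close>, the placeholder is \<open>Inl h\<close> and already in place.\<close>
  define \<sigma> where
    "\<sigma> = case_sum Inl (\<lambda>(i, v). if i = k then Inr (k, a) else (Inr (i, v) :: 'a + nat \<times> nat))"
  let ?gr = "glue_in h (j, snd (us0 ! j))" and ?g = "glue_in h (j, snd (us ! j))"
  have \<sigma>_i: "\<sigma> (?gr (i, v)) = ?g (i, v)" if "i \<noteq> k" for i v
    using that us0_i by (auto simp: \<sigma>_def glue_in_def)
  have \<sigma>_k: "\<sigma> (?gr (k, 0)) = ?g (k, a)"
  proof (cases "k = j")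
    case True
    then have "?gr (k, 0) = Inl h" "?g (k, a) = Inl h"
      using us0_k by (simp_all add: glue_in_def a_def)
    then show ?thesis by (simp add: \<sigma>_def)
  next
    case False
    then show ?thesis by (simp add: \<sigma>_def glue_in_def)
  qed
  have \<sigma>_Inl: "\<sigma> (Inl v) = Inl v" for v by (simp add: \<sigma>_def)
  have rk: "(\<Union>i<ar R. F i) = F k \<union> (\<Union>i\<in>{..<ar R} - {k}. F i)"
    for F :: "nat \<Rightarrow> (nat \<times> nat) list set" using jk by auto
  have A: "is_tree Sig ar (fst (us ! k))" "a \<in> verts (fst (us ! k))"
    using rtreesD[OF us[OF jk(2)]] by (auto simp: a_def)
  have vsplit: "{(i, v). i < ar R \<and> v \<in> verts (fst (ts ! i))} =
      Pair k ` verts (fst (ts ! k)) \<union> {(i, v). i < ar R \<and> i \<noteq> k \<and> v \<in> verts (fst (ts ! i))}"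
    for ts :: "((nat, 'r) struc \<times> nat) list"
    using jk by auto
  have vsame: "{(i, v). i < ar R \<and> i \<noteq> k \<and> v \<in> verts (fst (us0 ! i))} =
      {(i, v). i < ar R \<and> i \<noteq> k \<and> v \<in> verts (fst (us ! i))}" (is "_ = ?M")
    using us0_i by auto
  have \<sigma>_M: "(\<lambda>p. \<sigma> (?gr p)) ` ?M = ?g ` ?M"
    using \<sigma>_i by (intro image_cong) auto
  have \<sigma>rest: "\<sigma> ` verts rest = Inl ` verts H \<union> {?g (k, a)} \<union> ?g ` ?M"
    unfolding vrest vsplit[of us0] vsame image_Un image_image \<sigma>_Inl \<sigma>_M
    using us0_k \<sigma>_k by auto
  have vX: "verts (glue H h (concat R us) (j, snd (us ! j))) =
      Inl ` verts H \<union> ?g ` (Pair k ` verts (fst (us ! k))) \<union> ?g ` ?M"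
    unfolding verts_glue[OF H(2) rt] verts_concat R vsplit[of us] image_Un by blast
  show "iso Sig (glue rest c (fst (us ! k)) (snd (us ! k)))
           (glue H h (concat R us) (j, snd (us ! j)))"
    unfolding a_def[symmetric]
  proof (rule glue_iso[OF treeD(1)[OF tree] treeD(1)[OF A(1)] c A(2),
        where f = \<sigma> and g = "?g \<circ> Pair k"])
    show "inj_on \<sigma> (verts rest)"
    proof (rule inj_onI)
      fix x y assume xy: "x \<in> verts rest" "y \<in> verts rest" "\<sigma> x = \<sigma> y"
      \<comment> \<open>\<open>\<sigma>\<close> identifies all nodes of the form
        \<open>Inr (k, v)\<close>, but \<open>T0\<close> supplies only \<open>v = 0\<close>.\<close>
      have k0: "v = 0" if "Inr (k, v) \<in> verts rest" for v using that
        unfolding vrest using us0_k by (auto simp: glue_in_def split: if_splits)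
      have eq: "x = y \<or> (\<exists>v w. x = Inr (k, v) \<and> y = Inr (k, w))"
        using xy(3) by (auto simp: \<sigma>_def split: sum.splits if_splits)
      then show "x = y" using xy(1,2) k0 by metis
    qed
    show "inj_on (?g \<circ> Pair k) (verts (fst (us ! k)))"
      by (auto simp: inj_on_def glue_in_def split: if_splits)
    show "\<sigma> c = (?g \<circ> Pair k) a" using \<sigma>_k by (simp add: c_def)
    show "\<sigma> ` verts rest \<inter> (?g \<circ> Pair k) ` verts (fst (us ! k)) \<subseteq> {\<sigma> c}"
      unfolding \<sigma>rest c_def \<sigma>_k by (auto simp: glue_in_def a_def split: if_splits)
    show "verts (glue H h (concat R us) (j, snd (us ! j))) =
        \<sigma> ` verts rest \<union> (?g \<circ> Pair k) ` verts (fst (us ! k))"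
      unfolding \<sigma>rest vX using A(2) by auto
    fix S
    have e: "map \<sigma> (map ?gr (map (\<lambda>i. (i, snd (us0 ! i))) [0..<ar R])) =
        map ?g (map (\<lambda>i. (i, snd (us ! i))) [0..<ar R])"
    proof -
      have "\<sigma> (?gr (i, snd (us0 ! i))) = ?g (i, snd (us ! i))" for i
        using \<sigma>_i \<sigma>_k us0_i us0_k by (cases "i = k") (simp_all add: a_def)
      then show ?thesis by simp
    qed
    have m: "map \<sigma> ` map ?gr ` map (Pair i) ` rels (fst (us0 ! i)) S =
        map ?g ` map (Pair i) ` rels (fst (us ! i)) S" if "i \<in> {..<ar R} - {k}" for i
      using that \<sigma>_i us0_i by (auto simp: image_image o_def)
    have m': "(\<Union>i\<in>{..<ar R} - {k}. map \<sigma> ` map ?gr ` map (Pair i) ` rels (fst (us0 ! i)) S) =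
        (\<Union>i\<in>{..<ar R} - {k}. map ?g ` map (Pair i) ` rels (fst (us ! i)) S)"
      using m by (rule SUP_cong[OF refl])
    have rel: "rels (concat R ts) S = map (Pair k) ` rels (fst (ts ! k)) S \<union>
        (\<Union>i\<in>{..<ar R} - {k}. map (Pair i) ` rels (fst (ts ! i)) S) \<union>
        (if S = R then {map (\<lambda>i. (i, snd (ts ! i))) [0..<ar R]} else {})"
      if "length ts = ar R" for ts
      unfolding rels_concat that rk ..
    have "map \<sigma> ` rels rest S = map \<sigma> ` map Inl ` rels H S \<union>
        (\<Union>i\<in>{..<ar R} - {k}. map \<sigma> ` map ?gr ` map (Pair i) ` rels (fst (us0 ! i)) S) \<union>
        (if S = R then {map \<sigma> (map ?gr (map (\<lambda>i. (i, snd (us0 ! i))) [0..<ar R]))} else {})"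
      unfolding rest_def rels_glue rel[OF len0] image_Un image_UN
      using us0_k by (simp del: map_map)
    also have "map \<sigma> ` map Inl ` rels H S = map Inl ` rels H S"
      using \<sigma>_Inl by (auto simp: image_image o_def)
    finally show "rels (glue H h (concat R us) (j, snd (us ! j))) S =
        map \<sigma> ` rels rest S \<union> map (?g \<circ> Pair k) ` rels (fst (us ! k)) S"
      unfolding rels_glue rel[OF R(2)] m' e image_Un image_UN
      by (auto simp: image_image)
  qed
qed

text \<open>\<open>Ominus\<close> collects rooted forests, while the vertices of \<open>D\<close>
  consist of trees; for a tree only the condition on the sum remains.\<close>

lemma mem_Ominus:
  assumes "(A, a) \<in> rtrees Sig ar"
  shows "(A, a) \<in> Ominus Sig ar Obs H h \<longleftrightarrow> inO Sig Obs (glue H h A a)"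
  using assms by (auto simp: Ominus_def rforests_def rtrees_def is_tree_def)

text \<open>With all other components and \<open>H\<close> gathered into a context \<open>K\<close>,
  the hypothesis \<open>replace\<close> exchanges a single component while the whole stays in
  \<open>Obs\<close>. Doing this for each position in turn exchanges all of them.\<close>

lemma replace_all:
  fixes H :: "(nat, 'r) struc"
  assumes R: "R \<in> Sig" "length ts = ar R" and ts: "\<And>i. i < ar R \<Longrightarrow> ts ! i \<in> rtrees Sig ar"
    and H: "is_tree Sig ar H" "h \<in> verts H" and j: "j < ar R"
    and P: "\<And>i. i < ar R \<Longrightarrow> P i \<subseteq> rtrees Sig ar"
    and replace: "\<And>i K c. i < ar R \<Longrightarrow> (K, c) \<in> rtrees Sig ar \<Longrightarrow>
      inO Sig Obs (glue K c (fst (ts ! i)) (snd (ts ! i))) \<Longrightarrow>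
      \<exists>t\<in>P i. inO Sig Obs (glue K c (fst t) (snd t))"
    and inO: "inO Sig Obs (glue H h (concat R ts) (j, snd (ts ! j)))"
  shows "\<exists>us. length us = ar R \<and> (\<forall>i<ar R. us ! i \<in> P i) \<and>
    inO Sig Obs (glue H h (concat R us) (j, snd (us ! j)))"
proof -
  \<comment> \<open>Intermediate lists: the first \<open>k\<close> entries are replaced and the
    remaining ones still come from \<open>ts\<close>.\<close>
  have "\<exists>us. length us = ar R \<and> (\<forall>i<k. us ! i \<in> P i) \<and> (\<forall>i. k \<le> i \<longrightarrow> i < ar R \<longrightarrow> us ! i = ts ! i) \<and>
    inO Sig Obs (glue H h (concat R us) (j, snd (us ! j)))" if "k \<le> ar R" for k
    using that
  proof (induction k)
    case 0
    then show ?case using R inO by auto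
  next
    case (Suc k)
    then obtain us where us: "length us = ar R" "\<And>i. i < k \<Longrightarrow> us ! i \<in> P i"
      "\<And>i. k \<le> i \<Longrightarrow> i < ar R \<Longrightarrow> us ! i = ts ! i"
      and O: "inO Sig Obs (glue H h (concat R us) (j, snd (us ! j)))" by auto
    have k: "k < ar R" using Suc.prems by simp
    have usr: "us ! i \<in> rtrees Sig ar" if "i < ar R" for i
      using us(2)[of i] us(3)[of i] P[of i] ts[of i] that by (cases "i < k") auto
    define us0 where "us0 = us[k := (T0, 0)]"
    define rest where "rest = glue H h (concat R us0) (j, snd (us0 ! j))"
    define c where "c = glue_in h (j, snd (us0 ! j)) (k, 0)"
    note split = glue_concat_split[OF R(1) us(1) usr H j k, folded us0_def,
        folded rest_def c_def]
    \<comment> \<open>\<open>replace\<close> speaks of structures on natural numbers, whereas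
      \<open>rest\<close> has a sum type as vertex type; \<open>to_nat\<close> provides a
      copy.\<close>
    define K where "K = mapS to_nat rest"
    have K: "is_tree Sig ar K" "to_nat c \<in> verts K"
      using split(1,2) tree_mapS inj_to_nat unfolding K_def by (auto intro: inj_on_subset)
    have copy: "iso Sig (glue rest c (fst t) (snd t)) (glue K (to_nat c) (fst t) (snd t))"
      if "t \<in> rtrees Sig ar" for t
      unfolding K_def
      by (rule glue_mapS_left_iso[OF treeD(1)[OF split(1)] treeD(1)[OF rtreesD[OF that, THEN conjunct1]] split(2)
            rtreesD[OF that, THEN conjunct2] inj_on_subset[OF inj_to_nat subset_UNIV]])
    have "inO Sig Obs (glue K (to_nat c) (fst (ts ! k)) (snd (ts ! k)))"
      using O inO_iso[OF split(3)] inO_iso[OF copy[OF usr[OF k]]] us(3) k by simp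
    then obtain t where t: "t \<in> P k" "inO Sig Obs (glue K (to_nat c) (fst t) (snd t))"
      using replace[OF k, of K "to_nat c"] K unfolding rtrees_iff by blast
    have tr: "t \<in> rtrees Sig ar" using P k t by auto
    define us' where "us' = us[k := t]"
    have us'r: "us' ! i \<in> rtrees Sig ar" if "i < ar R" for i
      using usr[OF that] tr that us(1) unfolding us'_def by (cases "i = k") auto
    have us': "length us' = ar R" "us' ! k = t" "us'[k := (T0, 0)] = us0"
      using us(1) k by (auto simp: us'_def us0_def)
    \<comment> \<open>The lists before and after the exchange differ only at \<open>k\<close>, so
      both split off the same context \<open>rest\<close> at the same vertex
      \<open>c\<close>.\<close>
    note split' = glue_concat_split(3)[OF R(1) us'(1) us'r H j k, unfolded us',
        folded rest_def c_def]
    have "inO Sig Obs (glue H h (concat R us') (j, snd (us' ! j)))"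
      using t(2) inO_iso[OF split'] inO_iso[OF copy[OF tr]] by simp
    moreover have "us' ! i \<in> P i" if "i < Suc k" for i
      using us(2)[of i] that t us'(2) unfolding us'_def by (cases "i = k") auto
    moreover have "us' ! i = ts ! i" if "Suc k \<le> i" "i < ar R" for i
      using us(3)[of i] that unfolding us'_def by simp
    ultimately show ?case using us'(1) by blast
  qed
  from this[of "ar R"] show ?thesis by blast
qed

section \<open>Invariance of the vertices of \<open>D\<close> under isomorphism\<close>

lemma inO_glue_riso:
  fixes A C :: "(nat, 'r) struc"
  assumes "(A, a) \<in> rtrees Sig ar" "(C, c) \<in> rtrees Sig ar" "riso Sig (A, a) (C, c)"
    and "(H, h) \<in> rtrees Sig ar"
  shows "inO Sig Obs (glue H h A a) \<longleftrightarrow> inO Sig Obs (glue H h C c)"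
proof -
  obtain f where f: "isom Sig f A C" "f a = c" using assms(3) by (auto simp: riso_isom)
  have A: "is_tree Sig ar A" "a \<in> verts A" and H: "is_tree Sig ar H" "h \<in> verts H"
    and C: "is_tree Sig ar C" using assms by (auto simp: rtrees_iff)
  note eq = isom_eq_mapS[OF f(1) treeD(1)[OF A(1)] treeD(1)[OF C]]
  have "iso Sig (glue H h A a) (glue H h C c)"
    using glue_mapS_right_iso[OF treeD(1)[OF H(1)] treeD(1)[OF A(1)] H(2) A(2) eq(2)] eq(1) f(2)
    by simp
  then show ?thesis by (rule inO_iso)
qed

text \<open>Each set \<open>Ominus\<close> is invariant under isomorphism among rooted trees, and by
  (iii) so is \<open>V\<close>. Hence membership of a class passes to any chosen
  representative.\<close>

lemma D_verts_rmem:
  assumes V: "V \<in> D_verts Sig ar Obs" and X: "rmem Sig V (X, x)" "x \<in> verts X"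
    and C: "riso Sig (X, x) (C, c)" "(C, c) \<in> rtrees Sig ar"
  shows "(C, c) \<in> V"
proof -
  obtain \<H> where H: "\<H> \<subseteq> rtrees Sig ar" "V = rtrees Sig ar - (\<Union>(H, h)\<in>\<H>. Ominus Sig ar Obs H h)"
    using V by (auto simp: D_verts_def)
  obtain A a where A: "(A, a) \<in> V" "riso Sig (X, x) (A, a)" using X(1) by (auto simp: rmem_def)
  have r: "riso Sig (A, a) (C, c)" using riso_trans[OF riso_sym[OF X(2) A(2)] C(1)] .
  have Ar: "(A, a) \<in> rtrees Sig ar" using A(1) H(2) by blast
  have "(C, c) \<notin> Ominus Sig ar Obs H h" if "(H, h) \<in> \<H>" for H h
  proof -
    have "(A, a) \<notin> Ominus Sig ar Obs H h" using A(1) H(2) that by blast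
    then show ?thesis
      using inO_glue_riso[OF Ar C(2) r] H(1) that mem_Ominus[OF Ar] mem_Ominus[OF C(2)] by blast
  qed
  then show ?thesis using C(2) H(2) by blast
qed

section \<open>Cutting a tree at a block\<close>

text \<open>The component of the \<open>i\<close>-th entry after deletion of the block, that is, the
  subtree hanging there. The vertex names of \<open>T\<close> are kept, so a homomorphism from
  \<open>T\<close> restricts without change.\<close>

definition piece :: "(nat, 'r) struc \<Rightarrow> 'r \<Rightarrow> nat list \<Rightarrow> nat \<Rightarrow> (nat, 'r) struc" where
  "piece T R xs i =
    (let C = {v \<in> verts T. (xs ! i, v) \<in> (link Sig T {(R, xs)})\<^sup>*}
     in \<lparr>verts = C, rels = (\<lambda>S. {ys \<in> rels T S. (S, ys) \<noteq> (R, xs) \<and> set ys \<subseteq> C})\<rparr>)"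

lemma verts_piece:
    "verts (piece T R xs i) = {v \<in> verts T. (xs ! i, v) \<in> (link Sig T {(R, xs)})\<^sup>*}"
  and rels_piece: "rels (piece T R xs i) S =
    {ys \<in> rels T S. (S, ys) \<noteq> (R, xs) \<and> set ys \<subseteq> verts (piece T R xs i)}"
  by (simp_all add: piece_def Let_def)

text \<open>A remaining block links all its entries to one another, so it cannot leave a
  component.\<close>

lemma piece_closed:
  assumes "wf_struc Sig ar T" "ys \<in> rels T S" "(S, ys) \<noteq> (R, xs)"
    and "v \<in> set ys" "v \<in> verts (piece T R xs i)"
  shows "ys \<in> rels (piece T R xs i) S"
proof -
  have "w \<in> verts (piece T R xs i)" if w: "w \<in> set ys" for w
  proof -
    have "(v, w) \<in> link Sig T {(R, xs)}"
      using wf_rels(1)[OF assms(1,2)] assms(2-4) w by (auto simp: link_def)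
    then show ?thesis using assms(5) wf_rels(3)[OF assms(1,2)] w
      by (auto simp: verts_piece intro: rtrancl_into_rtrancl)
  qed
  then show ?thesis using assms(2,3) unfolding rels_piece[of T R xs i S] by blast
qed

lemma piece_rtree:
  assumes T: "is_tree Sig ar T" and R: "R \<in> Sig" "xs \<in> rels T R" and i: "i < ar R"
  shows "(piece T R xs i, xs ! i) \<in> rtrees Sig ar"
proof -
  note wf = treeD(1)[OF T]
  have xi: "xs ! i \<in> verts (piece T R xs i)"
    using wf_rels[OF wf R(2)] i by (auto simp: verts_piece)
  have "wf_struc Sig ar (piece T R xs i)"
    using wf unfolding wf_struc_def by (auto simp: verts_piece rels_piece)
  moreover have "acyc Sig (piece T R xs i)"
    using acyc_mono[OF treeD(2)[OF T]] by (auto simp: rels_piece)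
  \<comment> \<open>A walk from \<open>xs ! i\<close> that avoids the block uses only blocks of the
    piece, so it can be repeated inside the piece.\<close>
  moreover have "(xs ! i, v) \<in> (link Sig (piece T R xs i) {})\<^sup>*"
    if "(xs ! i, v) \<in> (link Sig T {(R, xs)})\<^sup>*" for v
    using that
  proof induction
    case (step y z)
    then obtain S ys where ys: "S \<in> Sig" "ys \<in> rels T S" "(S, ys) \<noteq> (R, xs)" "y \<in> set ys" "z \<in> set ys"
      by (auto simp: link_def)
    then have "y \<in> verts (piece T R xs i)"
      using step(1) wf_rels(3)[OF wf ys(2)] by (auto simp: verts_piece)
    then have "ys \<in> rels (piece T R xs i) S" using piece_closed[OF wf ys(2-4)] by blast
    then have "(y, z) \<in> link Sig (piece T R xs i) {}" using ys by (auto simp: link_def)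
    then show ?case using step.IH by (rule rtrancl_into_rtrancl[rotated])
  qed simp
  ultimately show ?thesis
    using xi treeI[of "piece T R xs i" "xs ! i"] unfolding rtrees_iff reach_def
    by (auto simp: verts_piece)
qed

text \<open>Follow a walk from the first entry: a step through the deleted block ends at an entry,
  which lies in its own piece, and any other step stays in the current piece.\<close>

lemma pieces_cover:
  assumes T: "is_tree Sig ar T" and R: "R \<in> Sig" "xs \<in> rels T R" and v: "v \<in> verts T"
  shows "\<exists>i<ar R. v \<in> verts (piece T R xs i)"
proof -
  note wf = treeD(1)[OF T]
  note xs = wf_rels[OF wf R(2)]
  have self: "\<exists>i<ar R. x \<in> verts (piece T R xs i)" if x: "x \<in> set xs" for x
  proof -
    obtain i where "i < ar R" "x = xs ! i" using x xs(2) by (auto simp: in_set_conv_nth)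
    then show ?thesis using x xs(3) by (auto simp: verts_piece)
  qed
  have "ar R > 0" using ar_pos R by blast
  then have x0: "xs ! 0 \<in> set xs" using xs by simp
  then have "reach Sig T (xs ! 0)" using treeD(3)[OF T] xs by blast
  then have "(xs ! 0, v) \<in> (link Sig T {})\<^sup>*" using v by (simp add: reach_def)
  then show ?thesis
  proof induction
    case base
    then show ?case using self x0 by blast
  next
    case (step y z)
    then obtain S ys where ys: "ys \<in> rels T S" "y \<in> set ys" "z \<in> set ys" by (auto simp: link_def)
    show ?case
    proof (cases "(S, ys) = (R, xs)")
      case True
      then show ?thesis using self ys by blast
    next
      case False
      from step.IH obtain i where i: "i < ar R" "y \<in> verts (piece T R xs i)" by blast
      have "ys \<in> rels (piece T R xs i) S" using piece_closed[OF wf ys(1) False ys(2) i(2)] .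
      then show ?thesis using i(1) ys(3) by (auto simp: rels_piece)
    qed
  qed
qed

text \<open>Cutting is inverse to concatenation; \<open>snd\<close> forgets the index of the piece.
  It is injective because the entries are separated and surjective because the pieces cover
  \<open>T\<close>.\<close>

lemma concat_pieces_isom:
  assumes T: "is_tree Sig ar T" and R: "R \<in> Sig" "xs \<in> rels T R"
  defines "ts \<equiv> map (\<lambda>i. (piece T R xs i, xs ! i)) [0..<ar R]"
  shows "isom Sig snd (concat R ts) T"
proof -
  note wf = treeD(1)[OF T]
  have len: "length xs = ar R" using wf_rels[OF wf R(2)] by simp
  have ts: "length ts = ar R" "\<And>i. i < ar R \<Longrightarrow> ts ! i = (piece T R xs i, xs ! i)"
    by (simp_all add: ts_def)
  have "is_tree Sig ar (concat R ts)"
    using tree_concat[OF R(1) ts(1)] ts(2) piece_rtree[OF T R] by simp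
  moreover have "inj_on snd (verts (concat R ts))"
  proof (rule inj_onI)
    fix p q assume pq: "p \<in> verts (concat R ts)" "q \<in> verts (concat R ts)" "snd p = snd q"
    let ?L = "(link Sig T {(R, xs)})\<^sup>*"
    have "(xs ! fst p, snd p) \<in> ?L" "(xs ! fst q, snd q) \<in> ?L" "fst p < ar R" "fst q < ar R"
      using pq(1,2) ts by (auto simp: verts_concat verts_piece)
    moreover from this have "(xs ! fst p, xs ! fst q) \<in> ?L"
      using pq(3) link_rtrancl_sym rtrancl_trans by metis
    moreover have "separated Sig T R xs" using treeD(2)[OF T] R by (simp add: acyc_def)
    ultimately have "fst p = fst q" using separatedD len by metis
    then show "p = q" using pq(3) by (simp add: prod_eq_iff)
  qed
  moreover have "T = mapS snd (concat R ts)"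
  proof (rule struc_eqI)
    show "verts T = verts (mapS snd (concat R ts))"
    proof (intro equalityI subsetI)
      fix v assume "v \<in> verts T"
      then obtain i where "i < ar R" "v \<in> verts (piece T R xs i)" using pieces_cover[OF T R] by blast
      then have "(i, v) \<in> verts (concat R ts)" using ts by (simp add: verts_concat)
      then show "v \<in> verts (mapS snd (concat R ts))" by force
    qed (use ts in \<open>auto simp: verts_concat verts_piece\<close>)
    fix S
    have e: "map snd (map (\<lambda>i. (i, snd (ts ! i))) [0..<length ts]) = xs"
      using ts len by (auto intro!: nth_equalityI)
    have "map snd ` map (Pair i) ` Y = Y" for i :: nat and Y :: "nat list set"
      by (auto simp: image_image o_def)
    then have relsS: "rels (mapS snd (concat R ts)) S =
        (\<Union>i<ar R. rels (piece T R xs i) S) \<union> (if S = R then {xs} else {})"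
      unfolding mapS_simps rels_concat image_Un image_UN using ts e by (auto simp del: map_map)
    have cover: "\<exists>i\<in>{..<ar R}. ys \<in> rels (piece T R xs i) S"
      if ys: "ys \<in> rels T S" "(S, ys) \<noteq> (R, xs)" for ys
    proof -
      have "set ys \<subseteq> verts T" "ys \<noteq> []" using wf_rels[OF wf ys(1)] ar_pos by auto
      then obtain v where "v \<in> set ys" "v \<in> verts T" by (cases ys) auto
      then show ?thesis using pieces_cover[OF T R] piece_closed[OF wf ys] by blast
    qed
    have sub: "rels (piece T R xs i) S \<subseteq> rels T S" for i by (auto simp: rels_piece)
    show "rels T S = rels (mapS snd (concat R ts)) S"
    proof (cases "S = R")
      case True
      then show ?thesis unfolding relsS using cover sub R by simp blast
    next
      case False
      then show ?thesis unfolding relsS using cover sub by simp blast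
    qed
  qed
  ultimately show ?thesis using isom_mapS treeD(1) by metis
qed

section \<open>A homomorphism to \<open>D\<close> places each rooted tree in the image of its
  root\<close>

definition blocks :: "('v, 'r) struc \<Rightarrow> ('r \<times> 'v list) set" where
  "blocks A = {(R, xs). R \<in> Sig \<and> xs \<in> rels A R}"

lemma finite_blocks:
  assumes "finite Sig" "wf_struc Sig ar A" shows "finite (blocks A)"
proof (rule finite_subset)
  show "blocks A \<subseteq> (SIGMA R:Sig. {xs. set xs \<subseteq> verts A \<and> length xs = ar R})"
    using wf_rels[OF assms(2)] unfolding blocks_def by blast
  show "finite (SIGMA R:Sig. {xs. set xs \<subseteq> verts A \<and> length xs = ar R})"
    using assms by (auto simp: wf_struc_def intro!: finite_SigmaI finite_lists_length_eq)
qed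

text \<open>The root is arbitrary in the induction, since the pieces are rooted at the other entries
  of the block as well.\<close>

lemma rooted_tree_in_image:
  fixes T :: "(nat, 'r) struc"
  assumes fin: "finite Sig" and "is_tree Sig ar T" "a \<in> verts T" "hom Sig f T (D Sig ar Obs)"
  shows "(T, a) \<in> f a"
  using assms(2-4)
proof (induction T arbitrary: a rule: measure_induct_rule[where f = "\<lambda>T. card (blocks T)"])
  case (less T)
  note T = less.prems(1) and a = less.prems(2) and f = less.prems(3)
  note wf = treeD(1)[OF T]
  have Ta: "(T, a) \<in> rtrees Sig ar" using T a by (simp add: rtrees_iff)
  have fD: "f v \<in> D_verts Sig ar Obs" if "v \<in> verts T" for v
    using f that by (simp add: hom_def D_def)
  show ?case
  proof (cases "\<exists>R\<in>Sig. \<exists>xs\<in>rels T R. a \<in> set xs")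
    case True
    then obtain R xs j where R: "R \<in> Sig" "xs \<in> rels T R" and j: "j < ar R" "xs ! j = a"
      using wf_rels(2)[OF wf] by (metis in_set_conv_nth)
    have len: "length xs = ar R" using wf_rels[OF wf R(2)] by simp
    define ts where "ts = map (\<lambda>i. (piece T R xs i, xs ! i)) [0..<ar R]"
    have ts: "length ts = ar R" "\<And>i. i < ar R \<Longrightarrow> ts ! i = (piece T R xs i, xs ! i)"
      by (simp_all add: ts_def)
    have "ts ! i \<in> map f xs ! i" if i: "i < ar R" for i
    proof -
      have "blocks (piece T R xs i) \<subseteq> blocks T - {(R, xs)}" by (auto simp: blocks_def rels_piece)
      moreover have "(R, xs) \<in> blocks T" using R by (simp add: blocks_def)
      \<comment> \<open>The deleted block belongs to no piece, so the number of blocks drops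
        strictly.\<close>
      ultimately have "card (blocks (piece T R xs i)) < card (blocks T)"
        by (intro psubset_card_mono finite_blocks[OF fin wf]) blast
      moreover have "hom Sig f (piece T R xs i) (D Sig ar Obs)"
        using f by (auto simp: hom_def verts_piece rels_piece)
      ultimately have "(piece T R xs i, xs ! i) \<in> f (xs ! i)"
        using less.IH piece_rtree[OF T R i] by (simp add: rtrees_iff)
      then show ?thesis using ts(2) i len by simp
    qed
    moreover have "map f xs \<in> rels (D Sig ar Obs) R" using f R by (simp add: hom_def)
    \<comment> \<open>The relation of \<open>D\<close> yields the concatenation of the pieces only
      up to isomorphism; the isomorphism with \<open>T\<close> and \<open>D_verts_rmem\<close> then
      give \<open>(T, a)\<close> itself.\<close>
    ultimately have "rmem Sig (map f xs ! j) (concat R ts, (j, snd (ts ! j)))"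
      using R(1) ts(1) j(1) unfolding D_def by (simp del: nth_map)
    then have "rmem Sig (f a) (concat R ts, (j, a))" using ts(2) j len by simp
    moreover have "(j, a) \<in> verts (concat R ts)"
      using root_concat[OF ts(1) j(1)] ts(2)[OF j(1)] piece_rtree[OF T R j(1)] j(2) by simp
    moreover have "riso Sig (concat R ts, (j, a)) (T, a)"
      using concat_pieces_isom[OF T R, folded ts_def] unfolding riso_isom by force
    ultimately show ?thesis by (rule D_verts_rmem[OF fD[OF a] _ _ _ Ta])
  next
    case False
    \<comment> \<open>Without a block at the root no link leaves it. By connectedness
      \<open>T\<close> is a copy of \<open>T0\<close>, and condition (i) applies.\<close>
    have "v = a" if v: "v \<in> verts T" for v
    proof -
      have "(a, v) \<in> (link Sig T {})\<^sup>*" using treeD(3)[OF T a] v by (simp add: reach_def)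
      then show ?thesis
        by (cases rule: converse_rtranclE) (use False in \<open>auto simp: link_def\<close>)
    qed
    then have vT: "verts T = {a}" using a by blast
    have "rels T R = {}" if "R \<in> Sig" for R
    proof (rule ccontr)
      assume "rels T R \<noteq> {}"
      then obtain xs where xs: "xs \<in> rels T R" by blast
      then have "set xs \<subseteq> {a}" "xs \<noteq> []" using wf_rels[OF wf xs] vT ar_pos by auto
      then have "a \<in> set xs" by (cases xs) auto
      then show False using False that xs by blast
    qed
    then have "isom Sig (\<lambda>_. a) T0 T" using vT by (simp add: isom_def)
    then have "riso Sig (T0, 0) (T, a)" unfolding riso_isom by blast
    moreover have "rmem Sig (f a) (T0, 0)" using fD[OF a] by (simp add: D_verts_def)
    ultimately show ?thesis using D_verts_rmem[OF fD[OF a] _ _ _ Ta, of T0 0] by simp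
  qed
qed

end

section \<open>The canonical map from \<open>B\<close> to \<open>D\<close>\<close>

lemma hom_trans: "hom Sig f A B \<Longrightarrow> hom Sig g B C \<Longrightarrow> hom Sig (g \<circ> f) A C"
  unfolding hom_def by (metis comp_apply map_map)

lemma isom_hom: "isom Sig f A B \<Longrightarrow> wf_struc Sig ar A \<Longrightarrow> hom Sig f A B"
  unfolding hom_def using wf_rels(3) by (fastforce simp: isom_def bij_betw_def)

context signature
begin

definition mapped_trees :: "('b, 'r) struc \<Rightarrow> 'b \<Rightarrow> ((nat, 'r) struc \<times> nat) set" where
  "mapped_trees B b = {(A, a) \<in> rtrees Sig ar. \<exists>f. hom Sig f A B \<and> f a = b}"

text \<open>The least set of the form (iii) that contains all rooted trees mapping to \<open>(B, b)\<close>.\<close>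
definition canon :: "(nat, 'r) struc set \<Rightarrow> ('b, 'r) struc \<Rightarrow> 'b \<Rightarrow> ((nat, 'r) struc \<times> nat) set" where
  "canon Obs B b = rtrees Sig ar -
     (\<Union>(K, c)\<in>{(K, c) \<in> rtrees Sig ar. Ominus Sig ar Obs K c \<inter> mapped_trees B b = {}}.
        Ominus Sig ar Obs K c)"

lemma mapped_trees_subset: "mapped_trees B b \<subseteq> canon Obs B b" "mapped_trees B b \<subseteq> rtrees Sig ar"
  by (auto simp: mapped_trees_def canon_def)

lemma canon_rtrees: "canon Obs B b \<subseteq> rtrees Sig ar"
  by (auto simp: canon_def)

lemma mem_Ominus': "t \<in> rtrees Sig ar \<Longrightarrow>
    t \<in> Ominus Sig ar Obs K c \<longleftrightarrow> inO Sig Obs (glue K c (fst t) (snd t))"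
  using mem_Ominus[of "fst t" "snd t"] by simp

text \<open>If \<open>Ominus\<close> of the context missed all of \<open>mapped_trees B b\<close>,
  it would be one of the sets removed in \<open>canon\<close>, and \<open>t\<close> would be removed
  with it.\<close>

lemma canon_replace:
  assumes "t \<in> canon Obs B b" "(K, c) \<in> rtrees Sig ar" "inO Sig Obs (glue K c (fst t) (snd t))"
  shows "\<exists>t'\<in>mapped_trees B b. inO Sig Obs (glue K c (fst t') (snd t'))"
proof -
  have "t \<in> rtrees Sig ar" using assms(1) canon_rtrees by (rule rev_subsetD)
  then have "t \<in> Ominus Sig ar Obs K c" using assms(3) mem_Ominus' by blast
  then have "Ominus Sig ar Obs K c \<inter> mapped_trees B b \<noteq> {}"
    using assms(1,2) unfolding canon_def by blast
  then show ?thesis using mem_Ominus' mapped_trees_subset(2)[of B b] by blast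
qed

text \<open>The converse of \<open>canon_replace\<close>: membership in \<open>canon\<close> is
  exactly replaceability in every context that is a rooted tree.\<close>

lemma canonI:
  assumes "t \<in> rtrees Sig ar"
    and "\<And>K c. (K, c) \<in> rtrees Sig ar \<Longrightarrow> inO Sig Obs (glue K c (fst t) (snd t)) \<Longrightarrow>
      \<exists>t'\<in>mapped_trees B b. inO Sig Obs (glue K c (fst t') (snd t'))"
  shows "t \<in> canon Obs B b"
proof -
  have "Ominus Sig ar Obs K c \<inter> mapped_trees B b \<noteq> {}"
    if "(K, c) \<in> rtrees Sig ar" "t \<in> Ominus Sig ar Obs K c" for K c
    using assms(2)[OF that(1)] that(2) mem_Ominus'[OF assms(1)] mem_Ominus' mapped_trees_subset(2)[of B b]
    by blast
  then show ?thesis using assms(1) unfolding canon_def by blast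
qed

text \<open>For (ii), the context \<open>T0\<close> turns a member of \<open>canon\<close> lying in
  \<open>Obs\<close> into a tree of \<open>Obs\<close> that maps to \<open>B\<close>, which is
  excluded. Conditions (i) and (iii) hold because \<open>T0\<close> maps to any vertex and by the
  form of \<open>canon\<close>.\<close>

lemma canon_D_verts:
  fixes B :: "('b, 'r) struc" and Obs :: "(nat, 'r) struc set"
  assumes Obs: "Obs \<subseteq> trees Sig ar" and free: "\<not> (\<exists>T\<in>Obs. \<exists>h. hom Sig h T B)"
    and b: "b \<in> verts B"
  shows "canon Obs B b \<in> D_verts Sig ar Obs"
proof -
  have T0: "(T0, 0) \<in> rtrees Sig ar" using tree_T0 by (simp add: rtrees_iff)
  moreover have "hom Sig (\<lambda>_. b) T0 B" using b by (simp add: hom_def)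
  ultimately have "(T0, 0) \<in> mapped_trees B b" by (auto simp: mapped_trees_def)
  then have "(T0, 0) \<in> canon Obs B b" using mapped_trees_subset(1) by (rule rev_subsetD)
  moreover have "riso Sig (T0, 0) (T0, 0 :: nat)"
    unfolding riso_isom by (intro exI[of _ id]) (simp add: isom_def)
  ultimately have "rmem Sig (canon Obs B b) (T0, 0)" by (auto simp: rmem_def)
  moreover have "\<not> inO Sig Obs A" if A: "(A, a) \<in> canon Obs B b" for A a
  proof
    assume O: "inO Sig Obs A"
    have glueT0: "inO Sig Obs (glue T0 0 (fst t) (snd t)) \<longleftrightarrow> inO Sig Obs (fst t)"
      if "t \<in> rtrees Sig ar" for t
      using rtreesD[OF that] by (intro inO_iso glue_T0_iso) (auto dest: treeD(1))
    have "(A, a) \<in> rtrees Sig ar" using A canon_rtrees by (rule rev_subsetD)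
    from glueT0[OF this] O have "inO Sig Obs (glue T0 0 (fst (A, a)) (snd (A, a)))" by simp
    from canon_replace[OF A T0 this] obtain t where t: "t \<in> mapped_trees B b"
      "inO Sig Obs (glue T0 0 (fst t) (snd t))" by blast
    then have "inO Sig Obs (fst t)" using glueT0 mapped_trees_subset(2)[of B b] by blast
    \<comment> \<open>Membership in \<open>Obs\<close> is up to isomorphism, so the homomorphism is
      carried back to an actual element \<open>C\<close> of \<open>Obs\<close>.\<close>
    then obtain C \<phi> where C: "C \<in> Obs" "isom Sig \<phi> C (fst t)"
      unfolding inO_def using iso_sym iso_isom by metis
    have "wf_struc Sig ar C" using C(1) Obs treeD(1) by (auto simp: trees_def)
    moreover obtain f where "hom Sig f (fst t) B" using t(1) by (auto simp: mapped_trees_def)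
    ultimately have "hom Sig (f \<circ> \<phi>) C B" using hom_trans isom_hom[OF C(2)] by blast
    then show False using C(1) free by blast
  qed
  moreover have "\<exists>\<H>\<subseteq>rtrees Sig ar.
      canon Obs B b = rtrees Sig ar - (\<Union>(A, a)\<in>\<H>. Ominus Sig ar Obs A a)"
    unfolding canon_def
    by (intro exI[of _ "{(K, c) \<in> rtrees Sig ar. Ominus Sig ar Obs K c \<inter> mapped_trees B b = {}}"]) auto
  ultimately show ?thesis unfolding D_verts_def by blast
qed

text \<open>The homomorphisms of the components combine freely, as the components are disjoint; the
  new block goes to \<open>bs\<close>, which is a tuple of \<open>B\<close>.\<close>

lemma concat_mapped:
  assumes R: "R \<in> Sig" "bs \<in> rels B R" and len: "length bs = ar R" "length us = ar R"
    and us: "\<And>i. i < ar R \<Longrightarrow> us ! i \<in> mapped_trees B (bs ! i)"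
  obtains m where "hom Sig m (concat R us) B" "\<And>i. i < ar R \<Longrightarrow> m (i, snd (us ! i)) = bs ! i"
proof -
  have "\<forall>i. \<exists>f. i < ar R \<longrightarrow> hom Sig f (fst (us ! i)) B \<and> f (snd (us ! i)) = bs ! i"
    using us by (fastforce simp: mapped_trees_def case_prod_unfold)
  then obtain m where m: "\<And>i. i < ar R \<Longrightarrow> hom Sig (m i) (fst (us ! i)) B"
    "\<And>i. i < ar R \<Longrightarrow> m i (snd (us ! i)) = bs ! i" by metis
  have "map (case_prod m) (map (\<lambda>i. (i, snd (us ! i))) [0..<ar R]) = bs"
    using m(2) len(1) by (intro nth_equalityI) auto
  moreover have "map (case_prod m) (map (Pair i) zs) = map (m i) zs" for i zs by simp
  ultimately have "map (case_prod m) xs \<in> rels B S"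
    if "S \<in> Sig" "xs \<in> rels (concat R us) S" for S xs
    using that R len m(1) unfolding rels_concat hom_def
    by (auto simp del: map_map split: if_splits)
  moreover have "case_prod m p \<in> verts B" if "p \<in> verts (concat R us)" for p
    using that m(1) len by (auto simp: verts_concat hom_def)
  ultimately have "hom Sig (case_prod m) (concat R us) B" by (simp add: hom_def)
  then show thesis using that m(2) by simp
qed

text \<open>In any context where the concatenation lies in \<open>Obs\<close>, its components can be
  replaced by trees that map to the entries of \<open>bs\<close>. The new concatenation then maps to
  \<open>B\<close> with its root at \<open>bs ! j\<close>, which is what \<open>canonI\<close> asks
  for.\<close>

lemma canon_rels:
  fixes B :: "('b, 'r) struc" and Obs :: "(nat, 'r) struc set"
  assumes R: "R \<in> Sig" "bs \<in> rels B R" and len: "length bs = ar R" "length ts = ar R"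
    and ts: "\<And>i. i < ar R \<Longrightarrow> ts ! i \<in> canon Obs B (bs ! i)" and j: "j < ar R"
  shows "rmem Sig (canon Obs B (bs ! j)) (concat R ts, (j, snd (ts ! j)))"
proof -
  \<comment> \<open>A concatenation lives on pairs, but the members of \<open>canon\<close> live on
    natural numbers, hence a rooted copy.\<close>
  let ?copy = "\<lambda>us. (mapS to_nat (concat R us), to_nat (j, snd (us ! j)))"
  have inj: "inj_on to_nat (verts (concat R us))" for us
    using inj_to_nat by (rule inj_on_subset) simp
  have copy: "?copy us \<in> rtrees Sig ar"
    "(H, h) \<in> rtrees Sig ar \<Longrightarrow>
      inO Sig Obs (glue H h (fst (?copy us)) (snd (?copy us))) \<longleftrightarrow>
      inO Sig Obs (glue H h (concat R us) (j, snd (us ! j)))"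
    if us: "length us = ar R" "\<And>i. i < ar R \<Longrightarrow> us ! i \<in> rtrees Sig ar" for us and H :: "(nat, 'r) struc" and h
  proof -
    note c = tree_concat[OF R(1) us] and r = root_concat[OF us(1) j us(2)[OF j]]
    show "?copy us \<in> rtrees Sig ar"
      unfolding rtrees_iff using tree_mapS[OF c inj] r by simp
    assume "(H, h) \<in> rtrees Sig ar"
    then have H: "is_tree Sig ar H" "h \<in> verts H" by (auto simp: rtrees_iff)
    show "inO Sig Obs (glue H h (fst (?copy us)) (snd (?copy us))) \<longleftrightarrow>
      inO Sig Obs (glue H h (concat R us) (j, snd (us ! j)))"
      using inO_iso[OF glue_mapS_right_iso[OF treeD(1)[OF H(1)] treeD(1)[OF c] H(2) r inj]]
      by simp
  qed
  have tsr: "ts ! i \<in> rtrees Sig ar" if "i < ar R" for i using ts[OF that] canon_rtrees by (rule rev_subsetD)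
  have "?copy ts \<in> canon Obs B (bs ! j)"
  proof (rule canonI)
    show "?copy ts \<in> rtrees Sig ar" using copy(1)[OF len(2) tsr] .
    fix H h assume H: "(H, h) \<in> rtrees Sig ar"
      and "inO Sig Obs (glue H h (fst (?copy ts)) (snd (?copy ts)))"
    then have O: "inO Sig Obs (glue H h (concat R ts) (j, snd (ts ! j)))"
      using copy(2)[OF len(2) tsr H] by blast
    have H': "is_tree Sig ar H" "h \<in> verts H" using H by (auto simp: rtrees_iff)
    obtain us where us: "length us = ar R" "\<And>i. i < ar R \<Longrightarrow> us ! i \<in> mapped_trees B (bs ! i)"
      "inO Sig Obs (glue H h (concat R us) (j, snd (us ! j)))"
      using replace_all[where P = "\<lambda>i. mapped_trees B (bs ! i)",
          OF R(1) len(2) tsr H' j mapped_trees_subset(2) canon_replace[OF ts] O]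
      by blast
    have usr: "us ! i \<in> rtrees Sig ar" if "i < ar R" for i
      using us(2)[OF that] mapped_trees_subset(2) by (rule rev_subsetD)
    obtain m where m: "hom Sig m (concat R us) B" "\<And>i. i < ar R \<Longrightarrow> m (i, snd (us ! i)) = bs ! i"
      using concat_mapped[OF R len(1) us(1,2)] by blast
    \<comment> \<open>\<open>from_nat\<close> undoes the renaming before the combined homomorphism
      is applied.\<close>
    have "hom Sig (m \<circ> from_nat) (mapS to_nat (concat R us)) B"
      using m(1) by (auto simp: hom_def o_def)
    then have "?copy us \<in> mapped_trees B (bs ! j)"
      using copy(1)[OF us(1) usr] m(2)[OF j] unfolding mapped_trees_def by force
    moreover have "inO Sig Obs (glue H h (fst (?copy us)) (snd (?copy us)))"
      using copy(2)[OF us(1) usr H] us(3) by blast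
    ultimately show "\<exists>t'\<in>mapped_trees B (bs ! j). inO Sig Obs (glue H h (fst t') (snd t'))"
      by blast
  qed
  moreover have "riso Sig (concat R ts, (j, snd (ts ! j))) (?copy ts)"
    unfolding riso_isom
    using isom_mapS[OF treeD(1)[OF tree_concat[OF R(1) len(2) tsr]] inj] by blast
  ultimately show ?thesis unfolding rmem_def by blast
qed

end

section \<open>The equivalence, assembled from the two directions\<close>

theorem theorem4p3:
  fixes Sig :: "'r set" and ar :: "'r \<Rightarrow> nat"
    and Obs :: "(nat, 'r) struc set" and B :: "('b, 'r) struc"
  assumes "finite Sig"
    and "\<forall>R\<in>Sig. ar R > 0"
    and "Obs \<subseteq> trees Sig ar"
    and "regular Sig ar Obs"
    and "wf_struc Sig ar B"
  shows "(\<exists>h. hom Sig h B (D Sig ar Obs)) \<longleftrightarrow> \<not> (\<exists>T\<in>Obs. \<exists>h. hom Sig h T B)"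
proof
  interpret signature Sig ar by unfold_locales (rule assms(2))
  show "\<not> (\<exists>T\<in>Obs. \<exists>h. hom Sig h T B)" if ex: "\<exists>h. hom Sig h B (D Sig ar Obs)"
  proof (intro notI, elim bexE exE)
    fix T g assume T: "T \<in> Obs" and g: "hom Sig g T B"
    obtain h where h: "hom Sig h B (D Sig ar Obs)" using ex by blast
    have tree: "is_tree Sig ar T" using T assms(3) by (auto simp: trees_def)
    obtain a where a: "a \<in> verts T" using tree by (rule tree_nonempty)
    have f: "hom Sig (h \<circ> g) T (D Sig ar Obs)" by (rule hom_trans[OF g h])
    have "(T, a) \<in> (h \<circ> g) a" by (rule rooted_tree_in_image[OF assms(1) tree a f])
    moreover have "(h \<circ> g) a \<in> D_verts Sig ar Obs" using f a by (simp add: hom_def D_def)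
    \<comment> \<open>Condition (ii) for the vertex \<open>(h \<circ> g) a\<close>, which contains
      \<open>(T, a)\<close>.\<close>
    ultimately have "\<not> inO Sig Obs T" unfolding D_verts_def by blast
    then show False using T iso_refl unfolding inO_def by blast
  qed
  assume free: "\<not> (\<exists>T\<in>Obs. \<exists>h. hom Sig h T B)"
  have "map (canon Obs B) bs \<in> rels (D Sig ar Obs) R" if R: "R \<in> Sig" "bs \<in> rels B R" for R bs
  proof -
    have len: "length bs = ar R" "set bs \<subseteq> verts B" using wf_rels[OF assms(5) R(2)] by auto
    have "rmem Sig (canon Obs B (bs ! j)) (concat R ts, (j, snd (ts ! j)))"
      if "length ts = ar R" "\<forall>i<ar R. ts ! i \<in> canon Obs B (bs ! i)" "j < ar R" for ts j
      using canon_rels[OF R len(1) that(1) _ that(3)] that(2) by blast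
    then show ?thesis
      using R(1) len canon_D_verts[OF assms(3) free] by (auto simp: D_def)
  qed
  moreover have "canon Obs B b \<in> verts (D Sig ar Obs)" if "b \<in> verts B" for b
    using canon_D_verts[OF assms(3) free that] by (simp add: D_def)
  ultimately have "hom Sig (canon Obs B) B (D Sig ar Obs)" by (simp add: hom_def)
  then show "\<exists>h. hom Sig h B (D Sig ar Obs)" by blast
qed

end
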